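(* Let $(X,\Sigma,\mu)$ be a localizable measure space, $M=L^\infty(X,\Sigma,\mu)$, and let $N$ be a unital $C^*$-subalgebra of $M$. The following are equivalent: (i) $N$ is norm-densely spanned by its projections, and $\mathbb P(N)$ is order-closed in $\mathbb P(M)$. (ii) $N_{\rm sa}$ is monotone closed in $M_{\rm sa}$ (that is, $N_{\rm sa}$ is closed under suprema of bounded sets in $M_{\rm sa}$). (iii) $N$ is a weak* closed subalgebra of $M$. (iv) $N=L^\infty(X,\Sigma_0,\mu_{|\Sigma_0})$ for a $\sigma$-subalgebra $\Sigma_0$ of $\Sigma$ which is essentially order-closed in $\Sigma$ (i.e. $\{[\chi_E]\in\mathbb P(M):E\in\Sigma_0\}$ is closed under suprema in $\mathbb P(M)$).
   Context: $L^\infty(X,\Sigma,\mu)$ is the commutative $C^*$-algebra of essentially bounded complex measurable functions modulo $\mu$-a.e. equality. $\mathbb P(\cdot)$ denotes the set of projections of a $C^*$-algebra; in $M$ these are the classes $[\chi_E]$, $E\in\Sigma$. The subscript ${\rm sa}$ denotes the selfadjoint part. $(X,\Sigma,\mu)$ is localizable if $\mu$ is semifinite (every set of infinite measure contains a measurable subset of strictly positive finite measure) and every increasing net in $\mathbb P(M)$ has a supremum in $\mathbb P(M)$; in that case $M=L^1(X,\mu)^*$ canonically, which defines the weak* topology on $M$, and bounded subsets of $M_{\rm sa}$ have suprema in $M_{\rm sa}$. "$\mathbb P(N)$ is order-closed in $\mathbb P(M)$" means that for any increasing net in $\mathbb P(N)$ its supremum in $\mathbb P(M)$ belongs to $\mathbb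 P(N)$. $L^\infty(X,\Sigma_0,\mu_{|\Sigma_0})$ is regarded as the subalgebra of $M$ of classes of bounded $\Sigma_0$-measurable functions. *)

theory Defs
  imports "HOL-Probability.Essential_Supremum" "HOL-Probability.Conditional_Expectation"
begin

section \<open>The algebra of essentially bounded functions modulo null functions\<close>

definition Linf_fun :: "'a measure \<Rightarrow> ('a \<Rightarrow> complex) set" where
  "Linf_fun M = {f \<in> borel_measurable M. \<exists>C. AE x in M. norm (f x) \<le> C}"

definition ae_rel :: "'a measure \<Rightarrow> (('a \<Rightarrow> complex) \<times> ('a \<Rightarrow> complex)) set" where
  "ae_rel M = {(f, g). f \<in> Linf_fun M \<and> g \<in> Linf_fun M \<and> (AE x in M. f x = g x)}"

type_synonym 'a class_fun = "('a \<Rightarrow> complex) set"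

text \<open>Functions are total on the type, but their values outside \<^term>\<open>space M\<close> are irrelevant,
  since they affect neither measurability nor almost-everywhere equality.\<close>

definition Linf :: "'a measure \<Rightarrow> 'a class_fun set" where
  "Linf M = Linf_fun M // ae_rel M"

definition cls :: "'a measure \<Rightarrow> ('a \<Rightarrow> complex) \<Rightarrow> 'a class_fun" where
  "cls M f = ae_rel M `` {f}"

definition rep :: "'a class_fun \<Rightarrow> 'a \<Rightarrow> complex" where
  "rep \<phi> = (SOME f. f \<in> \<phi>)"

text \<open>The operations are defined on chosen representatives; independence of the choice is proved
  below.\<close>

definition Linf_zero :: "'a measure \<Rightarrow> 'a class_fun" where
  "Linf_zero M = cls M (\<lambda>_. 0)"

definition Linf_one :: "'a measure \<Rightarrow> 'a class_fun" where
  "Linf_one M = cls M (\<lambda>_. 1)"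

definition Linf_add :: "'a measure \<Rightarrow> 'a class_fun \<Rightarrow> 'a class_fun \<Rightarrow> 'a class_fun" where
  "Linf_add M \<phi> \<psi> = cls M (\<lambda>x. rep \<phi> x + rep \<psi> x)"

definition Linf_diff :: "'a measure \<Rightarrow> 'a class_fun \<Rightarrow> 'a class_fun \<Rightarrow> 'a class_fun" where
  "Linf_diff M \<phi> \<psi> = cls M (\<lambda>x. rep \<phi> x - rep \<psi> x)"

definition Linf_scale :: "'a measure \<Rightarrow> complex \<Rightarrow> 'a class_fun \<Rightarrow> 'a class_fun" where
  "Linf_scale M c \<phi> = cls M (\<lambda>x. c * rep \<phi> x)"

definition Linf_mult :: "'a measure \<Rightarrow> 'a class_fun \<Rightarrow> 'a class_fun \<Rightarrow> 'a class_fun" where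
  "Linf_mult M \<phi> \<psi> = cls M (\<lambda>x. rep \<phi> x * rep \<psi> x)"

definition Linf_star :: "'a measure \<Rightarrow> 'a class_fun \<Rightarrow> 'a class_fun" where
  "Linf_star M \<phi> = cls M (\<lambda>x. cnj (rep \<phi> x))"

definition Linf_norm :: "'a measure \<Rightarrow> 'a class_fun \<Rightarrow> real" where
  "Linf_norm M \<phi> = enn2real (esssup M (\<lambda>x. ennreal (norm (rep \<phi> x))))"

definition Linf_le :: "'a measure \<Rightarrow> 'a class_fun \<Rightarrow> 'a class_fun \<Rightarrow> bool" where
  "Linf_le M \<phi> \<psi> \<longleftrightarrow> (AE x in M. rep \<psi> x - rep \<phi> x \<in> \<real>\<^sub>\<ge>\<^sub>0)"

lemma equiv_ae_rel: "equiv (Linf_fun M) (ae_rel M)"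
  unfolding equiv_def refl_on_def sym_def trans_def ae_rel_def
  by (auto elim: eventually_mono eventually_elim2)

lemma cls_in_Linf: "f \<in> Linf_fun M \<Longrightarrow> cls M f \<in> Linf M"
  by (simp add: cls_def Linf_def quotientI)

lemma cls_eq_iff:
  assumes "f \<in> Linf_fun M" "g \<in> Linf_fun M"
  shows "cls M f = cls M g \<longleftrightarrow> (AE x in M. f x = g x)"
  using eq_equiv_class_iff[OF equiv_ae_rel assms] assms by (auto simp: cls_def ae_rel_def)

lemma rep_cls:
  assumes "f \<in> Linf_fun M"
  shows "rep (cls M f) \<in> Linf_fun M" "AE x in M. rep (cls M f) x = f x"
proof -
  have "f \<in> cls M f" using assms by (simp add: cls_def ae_rel_def)
  then have "rep (cls M f) \<in> cls M f" unfolding rep_def by (rule someI[of "\<lambda>g. g \<in> cls M f"])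
  then show "rep (cls M f) \<in> Linf_fun M" "AE x in M. rep (cls M f) x = f x"
    by (auto simp: cls_def ae_rel_def elim: eventually_mono)
qed

lemma cls_rep:
  assumes "\<phi> \<in> Linf M"
  shows "rep \<phi> \<in> Linf_fun M" "cls M (rep \<phi>) = \<phi>"
proof -
  obtain f where f: "f \<in> Linf_fun M" "\<phi> = cls M f"
    using assms by (auto simp: Linf_def cls_def elim: quotientE)
  then show "rep \<phi> \<in> Linf_fun M" "cls M (rep \<phi>) = \<phi>"
    using rep_cls[OF f(1)] cls_eq_iff[of "rep \<phi>" M f] by auto
qed

lemma Linf_fun_const: "(\<lambda>_. c) \<in> Linf_fun M"
  by (auto simp: Linf_fun_def)

lemma Linf_fun_indicator: "E \<in> sets M \<Longrightarrow> indicator E \<in> Linf_fun M"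
  by (auto simp: Linf_fun_def indicator_def intro!: exI[of _ 1])

lemma Linf_fun_add:
  assumes "f \<in> Linf_fun M" "g \<in> Linf_fun M"
  shows "(\<lambda>x. f x + g x) \<in> Linf_fun M"
proof -
  obtain C D where "AE x in M. norm (f x) \<le> C" "AE x in M. norm (g x) \<le> D"
    using assms by (auto simp: Linf_fun_def)
  then have "AE x in M. norm (f x + g x) \<le> C + D"
    by eventually_elim (rule norm_triangle_mono)
  with assms show ?thesis by (auto simp: Linf_fun_def)
qed

lemma Linf_fun_mult:
  assumes "f \<in> Linf_fun M" "g \<in> Linf_fun M"
  shows "(\<lambda>x. f x * g x) \<in> Linf_fun M"
proof -
  obtain C D where "AE x in M. norm (f x) \<le> C" "AE x in M. norm (g x) \<le> D"
    using assms by (auto simp: Linf_fun_def)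
  then have "AE x in M. norm (f x * g x) \<le> C * D"
  proof eventually_elim
    case (elim x)
    moreover from elim have "0 \<le> C" using norm_ge_zero order_trans by blast
    ultimately show ?case by (simp add: norm_mult mult_mono)
  qed
  with assms show ?thesis by (auto simp: Linf_fun_def)
qed

lemma Linf_fun_scale: "f \<in> Linf_fun M \<Longrightarrow> (\<lambda>x. c * f x) \<in> Linf_fun M"
  using Linf_fun_mult[OF Linf_fun_const] .

lemma Linf_fun_diff:
  assumes "f \<in> Linf_fun M" "g \<in> Linf_fun M"
  shows "(\<lambda>x. f x - g x) \<in> Linf_fun M"
  using Linf_fun_add[OF assms(1) Linf_fun_scale[OF assms(2), of "-1"]] by simp

lemma Linf_fun_cnj: "f \<in> Linf_fun M \<Longrightarrow> (\<lambda>x. cnj (f x)) \<in> Linf_fun M"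
  by (auto simp: Linf_fun_def intro!: borel_measurable_continuous_on[of cnj] continuous_intros)

lemma Linf_add_cls:
  assumes "f \<in> Linf_fun M" "g \<in> Linf_fun M"
  shows "Linf_add M (cls M f) (cls M g) = cls M (\<lambda>x. f x + g x)"
  unfolding Linf_add_def using assms rep_cls[OF assms(1)] rep_cls[OF assms(2)]
  by (subst cls_eq_iff) (auto simp: Linf_fun_add elim: eventually_elim2)

lemma Linf_diff_cls:
  assumes "f \<in> Linf_fun M" "g \<in> Linf_fun M"
  shows "Linf_diff M (cls M f) (cls M g) = cls M (\<lambda>x. f x - g x)"
  unfolding Linf_diff_def using assms rep_cls[OF assms(1)] rep_cls[OF assms(2)]
  by (subst cls_eq_iff) (auto simp: Linf_fun_diff elim: eventually_elim2)

lemma Linf_mult_cls: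
  assumes "f \<in> Linf_fun M" "g \<in> Linf_fun M"
  shows "Linf_mult M (cls M f) (cls M g) = cls M (\<lambda>x. f x * g x)"
  unfolding Linf_mult_def using assms rep_cls[OF assms(1)] rep_cls[OF assms(2)]
  by (subst cls_eq_iff) (auto simp: Linf_fun_mult elim: eventually_elim2)

lemma Linf_scale_cls:
  assumes "f \<in> Linf_fun M"
  shows "Linf_scale M c (cls M f) = cls M (\<lambda>x. c * f x)"
  unfolding Linf_scale_def using assms rep_cls[OF assms]
  by (subst cls_eq_iff) (auto simp: Linf_fun_scale elim: eventually_mono)

lemma Linf_star_cls:
  assumes "f \<in> Linf_fun M"
  shows "Linf_star M (cls M f) = cls M (\<lambda>x. cnj (f x))"
  unfolding Linf_star_def using assms rep_cls[OF assms]
  by (subst cls_eq_iff) (auto simp: Linf_fun_cnj elim: eventually_mono)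

lemma Linf_norm_cls:
  assumes "f \<in> Linf_fun M"
  shows "Linf_norm M (cls M f) = enn2real (esssup M (\<lambda>x. ennreal (norm (f x))))"
proof -
  have [measurable]: "f \<in> borel_measurable M" "rep (cls M f) \<in> borel_measurable M"
    using assms rep_cls(1)[OF assms] by (auto simp: Linf_fun_def)
  have "AE x in M. ennreal (norm (rep (cls M f) x)) = ennreal (norm (f x))"
    using rep_cls(2)[OF assms] by eventually_elim simp
  from Limsup_eq[OF this] show ?thesis
    unfolding Linf_norm_def esssup_def by simp
qed

lemma Linf_le_cls:
  assumes "f \<in> Linf_fun M" "g \<in> Linf_fun M"
  shows "Linf_le M (cls M f) (cls M g) \<longleftrightarrow> (AE x in M. g x - f x \<in> \<real>\<^sub>\<ge>\<^sub>0)"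
  unfolding Linf_le_def
proof (rule eventually_subst)
  show "AE x in M. (rep (cls M g) x - rep (cls M f) x \<in> \<real>\<^sub>\<ge>\<^sub>0) = (g x - f x \<in> \<real>\<^sub>\<ge>\<^sub>0)"
    using rep_cls(2)[OF assms(1)] rep_cls(2)[OF assms(2)] by eventually_elim simp
qed

section \<open>Subalgebras, selfadjoint parts, projections\<close>

definition Linf_subspace :: "'a measure \<Rightarrow> 'a class_fun set \<Rightarrow> bool" where
  "Linf_subspace M V \<longleftrightarrow> V \<subseteq> Linf M \<and> Linf_zero M \<in> V \<and>
     (\<forall>\<phi>\<in>V. \<forall>\<psi>\<in>V. Linf_add M \<phi> \<psi> \<in> V) \<and> (\<forall>c. \<forall>\<phi>\<in>V. Linf_scale M c \<phi> \<in> V)"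

definition norm_closure :: "'a measure \<Rightarrow> 'a class_fun set \<Rightarrow> 'a class_fun set" where
  "norm_closure M S = {\<phi> \<in> Linf M. \<forall>e>0. \<exists>\<psi>\<in>S. Linf_norm M (Linf_diff M \<phi> \<psi>) < e}"

text \<open>Unital means that the subalgebra contains the unit of the whole algebra.\<close>

definition unital_cstar_subalgebra :: "'a measure \<Rightarrow> 'a class_fun set \<Rightarrow> bool" where
  "unital_cstar_subalgebra M N \<longleftrightarrow> Linf_subspace M N \<and> Linf_one M \<in> N \<and>
     (\<forall>\<phi>\<in>N. \<forall>\<psi>\<in>N. Linf_mult M \<phi> \<psi> \<in> N) \<and> (\<forall>\<phi>\<in>N. Linf_star M \<phi> \<in> N) \<and>
     norm_closure M N \<subseteq> N"

definition sa_part :: "'a measure \<Rightarrow> 'a class_fun set \<Rightarrow> 'a class_fun set" where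
  "sa_part M N = {\<phi> \<in> N. Linf_star M \<phi> = \<phi>}"

definition projections :: "'a measure \<Rightarrow> 'a class_fun set \<Rightarrow> 'a class_fun set" where
  "projections M N = {p \<in> N. Linf_star M p = p \<and> Linf_mult M p p = p}"

definition densely_spanned_by_projections :: "'a measure \<Rightarrow> 'a class_fun set \<Rightarrow> bool" where
  "densely_spanned_by_projections M N \<longleftrightarrow>
     N = norm_closure M (Linf_subspace M hull projections M N)"

lemma projections_Linf: "projections M (Linf M) = {cls M (indicator E) |E. E \<in> sets M}"
proof (intro equalityI subsetI)
  fix p assume "p \<in> projections M (Linf M)"
  then have p: "p \<in> Linf M" "Linf_mult M p p = p" by (auto simp: projections_def)
  note r = cls_rep[OF p(1)]
  have [measurable]: "rep p \<in> borel_measurable M" using r(1) by (simp add: Linf_fun_def)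
  define E where "E = {x \<in> space M. rep p x = 1}"
  have E: "E \<in> sets M" unfolding E_def by measurable
  have "cls M (\<lambda>x. rep p x * rep p x) = cls M (rep p)"
    using Linf_mult_cls[OF r(1) r(1)] p r(2) by simp
  then have "AE x in M. rep p x * rep p x = rep p x"
    using r(1) by (subst (asm) cls_eq_iff) (auto simp: Linf_fun_mult)
  then have "AE x in M. rep p x = indicator E x"
    using AE_space by eventually_elim (auto simp: E_def indicator_def)
  then have "p = cls M (indicator E)"
    using r cls_eq_iff[OF r(1) Linf_fun_indicator[OF E]] by simp
  then show "p \<in> {cls M (indicator E) |E. E \<in> sets M}" using E by blast
next
  fix p assume "p \<in> {cls M (indicator E) |E. E \<in> sets M}"
  then obtain E where E: "E \<in> sets M" "p = cls M (indicator E)" by blast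
  have *: "(\<lambda>x. cnj (indicator E x)) = indicator E"
    "(\<lambda>x. indicator E x * indicator E x) = (indicator E :: 'a \<Rightarrow> complex)"
    by (auto simp: indicator_def)
  show "p \<in> projections M (Linf M)"
    using E Linf_fun_indicator[OF E(1)] cls_in_Linf
    by (simp add: projections_def Linf_star_cls Linf_mult_cls *)
qed

section \<open>Suprema and increasing nets\<close>

text \<open>\<open>is_supremum M A S s\<close>: \<open>s\<close> is the supremum of \<open>S\<close> in the ordered set \<open>A\<close>.\<close>

definition is_supremum ::
    "'a measure \<Rightarrow> 'a class_fun set \<Rightarrow> 'a class_fun set \<Rightarrow> 'a class_fun \<Rightarrow> bool" where
  "is_supremum M A S s \<longleftrightarrow> s \<in> A \<and> (\<forall>a\<in>S. Linf_le M a s) \<and>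
     (\<forall>u\<in>A. (\<forall>a\<in>S. Linf_le M a u) \<longrightarrow> Linf_le M s u)"

definition increasing_net ::
    "'a measure \<Rightarrow> 'a class_fun set \<Rightarrow> 'i set \<Rightarrow> ('i \<Rightarrow> 'i \<Rightarrow> bool) \<Rightarrow> ('i \<Rightarrow> 'a class_fun) \<Rightarrow> bool" where
  "increasing_net M P I r p \<longleftrightarrow> I \<noteq> {} \<and> reflp_on I r \<and> transp_on I r \<and>
     (\<forall>i\<in>I. \<forall>j\<in>I. \<exists>k\<in>I. r i k \<and> r j k) \<and> p \<in> I \<rightarrow> P \<and>
     (\<forall>i\<in>I. \<forall>j\<in>I. r i j \<longrightarrow> Linf_le M (p i) (p j))"

text \<open>HOL cannot quantify over the type of the index set inside a definition. Below, the index sets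
  are taken from the type of the elements of the algebra. This is no restriction: the range of an
  increasing net over any index type is again an increasing net, indexed by itself; see the lemmas
  \<open>localizable_any_index\<close> and \<open>projections_order_closed_any_index\<close>.\<close>

definition localizable :: "'a measure \<Rightarrow> bool" where
  "localizable M \<longleftrightarrow>
     (\<forall>E\<in>sets M. emeasure M E = \<infinity> \<longrightarrow>
        (\<exists>F\<in>sets M. F \<subseteq> E \<and> 0 < emeasure M F \<and> emeasure M F < \<infinity>)) \<and>
     (\<forall>(I :: 'a class_fun set) r p. increasing_net M (projections M (Linf M)) I r p \<longrightarrow>
        (\<exists>s. is_supremum M (projections M (Linf M)) (p ` I) s))"

definition projections_order_closed :: "'a measure \<Rightarrow> 'a class_fun set \<Rightarrow> bool" where
  "projections_order_closed M N \<longleftrightarrow>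
     (\<forall>(I :: 'a class_fun set) r p s. increasing_net M (projections M N) I r p \<longrightarrow>
        is_supremum M (projections M (Linf M)) (p ` I) s \<longrightarrow> s \<in> projections M N)"

lemma increasing_net_range:
  assumes "increasing_net M P I r p" "P \<subseteq> Linf M"
  shows "increasing_net M P (p ` I) (Linf_le M) (\<lambda>\<phi>. \<phi>)"
proof -
  have tr: "Linf_le M a c" if "Linf_le M a b" "Linf_le M b c" for a b c
    using that unfolding Linf_le_def
  proof eventually_elim
    case (elim x)
    then have "(rep b x - rep a x) + (rep c x - rep b x) \<in> \<real>\<^sub>\<ge>\<^sub>0" by (rule nonneg_Reals_add_I)
    then show ?case by simp
  qed
  have "reflp_on (p ` I) (Linf_le M)" by (auto simp: reflp_on_def Linf_le_def)
  moreover have "transp_on (p ` I) (Linf_le M)" using tr by (auto simp: transp_on_def)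
  ultimately show ?thesis
    using assms(1) unfolding increasing_net_def by (auto simp: Pi_iff) blast
qed

lemma localizable_any_index:
  assumes "localizable M" "increasing_net M (projections M (Linf M)) I r p"
  shows "\<exists>s. is_supremum M (projections M (Linf M)) (p ` I) s"
proof -
  have "increasing_net M (projections M (Linf M)) (p ` I) (Linf_le M) (\<lambda>\<phi>. \<phi>)"
    using increasing_net_range[OF assms(2)] by (auto simp: projections_def)
  then have "\<exists>s. is_supremum M (projections M (Linf M)) ((\<lambda>\<phi>. \<phi>) ` p ` I) s"
    using assms(1) unfolding localizable_def by blast
  then show ?thesis by simp
qed

lemma projections_order_closed_any_index:
  assumes "projections_order_closed M N" "N \<subseteq> Linf M"
    and "increasing_net M (projections M N) I r p"
    and "is_supremum M (projections M (Linf M)) (p ` I) s"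
  shows "s \<in> projections M N"
proof -
  have "increasing_net M (projections M N) (p ` I) (Linf_le M) (\<lambda>\<phi>. \<phi>)"
    using increasing_net_range[OF assms(3)] assms(2) by (auto simp: projections_def)
  moreover have "is_supremum M (projections M (Linf M)) ((\<lambda>\<phi>. \<phi>) ` p ` I) s"
    using assms(4) by simp
  ultimately show ?thesis
    using assms(1) unfolding projections_order_closed_def by blast
qed

text \<open>In a unital algebra, norm bounded and order bounded (on both sides) sets of selfadjoint
  elements are the same.\<close>

definition sa_monotone_closed :: "'a measure \<Rightarrow> 'a class_fun set \<Rightarrow> bool" where
  "sa_monotone_closed M N \<longleftrightarrow>
     (\<forall>A s. A \<subseteq> sa_part M N \<longrightarrow> (\<exists>C. \<forall>a\<in>A. Linf_norm M a \<le> C) \<longrightarrow>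
        is_supremum M (sa_part M (Linf M)) A s \<longrightarrow> s \<in> sa_part M N)"

section \<open>The weak* topology\<close>

definition L1_pairing :: "'a measure \<Rightarrow> 'a class_fun \<Rightarrow> ('a \<Rightarrow> complex) \<Rightarrow> complex" where
  "L1_pairing M \<phi> g = (\<integral>x. rep \<phi> x * g x \<partial>M)"

text \<open>The coarsest topology making all pairings with integrable functions continuous.\<close>

definition weak_star_topology :: "'a measure \<Rightarrow> 'a class_fun topology" where
  "weak_star_topology M = topology_generated_by
     {{\<phi> \<in> Linf M. L1_pairing M \<phi> g \<in> U} |g U. integrable M g \<and> open U}"

lemma topspace_weak_star_topology: "topspace (weak_star_topology M) = Linf M"
proof -
  have "Linf M \<in> {{\<phi> \<in> Linf M. L1_pairing M \<phi> g \<in> U} |g U. integrable M g \<and> open U}"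
    by (rule CollectI, rule exI[of _ "\<lambda>_. 0"], rule exI[of _ UNIV]) auto
  then show ?thesis
    unfolding weak_star_topology_def topology_generated_by_topspace by blast
qed

section \<open>Sub-sigma-algebras\<close>

text \<open>A sub-sigma-algebra is carried by a measure \<open>F\<close> with \<^prop>\<open>subalgebra M F\<close>; only
  \<^term>\<open>sets F\<close> matters, never the measure of \<open>F\<close> itself.\<close>

definition Linf_sub :: "'a measure \<Rightarrow> 'a measure \<Rightarrow> 'a class_fun set" where
  "Linf_sub M F = {cls M f |f. f \<in> borel_measurable F \<and> bounded (f ` space M)}"

lemma Linf_sub_eq_restr:
  assumes "subalgebra M F"
  shows "Linf_sub M F = cls M ` Linf_fun (restr_to_subalg M F)"
proof (intro equalityI subsetI)
  fix \<phi> assume "\<phi> \<in> Linf_sub M F"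
  then obtain f where f: "\<phi> = cls M f" "f \<in> borel_measurable F" "bounded (f ` space M)"
    by (auto simp: Linf_sub_def)
  then obtain C where "\<forall>x\<in>space M. norm (f x) \<le> C" by (auto simp: bounded_iff)
  then have "AE x in restr_to_subalg M F. norm (f x) \<le> C"
    by (intro AE_I2) (simp add: space_restr_to_subalg)
  then have "f \<in> Linf_fun (restr_to_subalg M F)"
    using f(2) measurable_in_subalg[OF assms] by (auto simp: Linf_fun_def)
  then show "\<phi> \<in> cls M ` Linf_fun (restr_to_subalg M F)" using f(1) by blast
next
  fix \<phi> assume "\<phi> \<in> cls M ` Linf_fun (restr_to_subalg M F)"
  then obtain f C where f: "\<phi> = cls M f" "f \<in> borel_measurable (restr_to_subalg M F)"
    "AE x in restr_to_subalg M F. norm (f x) \<le> C"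
    by (auto simp: Linf_fun_def)
  have fF[measurable]: "f \<in> borel_measurable F"
    using f(2) measurable_in_subalg'[OF assms] by blast
  define g where "g x = (if norm (f x) \<le> C then f x else 0)" for x
  have gF: "g \<in> borel_measurable F" unfolding g_def by measurable
  have gb: "norm (g x) \<le> \<bar>C\<bar>" for x by (auto simp: g_def)
  have fM: "f \<in> borel_measurable M" and gM: "g \<in> borel_measurable M"
    using fF gF measurable_from_subalg[OF assms] by blast+
  have AEf: "AE x in M. norm (f x) \<le> C"
    using f(3) AE_restr_to_subalg[OF assms] by blast
  have "f \<in> Linf_fun M" "g \<in> Linf_fun M"
    using fM gM AEf gb by (auto simp: Linf_fun_def)
  moreover have "AE x in M. f x = g x"
    using AEf by eventually_elim (simp add: g_def)
  ultimately have "\<phi> = cls M g" using f(1) cls_eq_iff by blast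
  moreover have "bounded (g ` space M)" using gb by (auto simp: bounded_iff)
  ultimately show "\<phi> \<in> Linf_sub M F" using gF by (auto simp: Linf_sub_def)
qed

definition essentially_order_closed :: "'a measure \<Rightarrow> 'a measure \<Rightarrow> bool" where
  "essentially_order_closed M F \<longleftrightarrow>
     (\<forall>S s. S \<subseteq> {cls M (indicator E) |E. E \<in> sets F} \<longrightarrow>
        is_supremum M (projections M (Linf M)) S s \<longrightarrow>
        s \<in> {cls M (indicator E) |E. E \<in> sets F})"

end

theory Submission
  imports Defs
begin

text \<open>The cycle (i) \<open>\<Longrightarrow>\<close> (iv) \<open>\<Longrightarrow>\<close> (iii) \<open>\<Longrightarrow>\<close> (ii) \<open>\<Longrightarrow>\<close> (i) avoids
  the duality \<open>M = L\<^sup>1(X, \<mu>)\<^sup>*\<close>.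
  For (i) \<open>\<Longrightarrow>\<close> (iv), the sets whose indicator has its class in \<open>N\<close> form \<open>\<Sigma>\<^sub>0\<close>.
  For (iv) \<open>\<Longrightarrow>\<close> (iii), \<open>N\<close> is shown to be the annihilator of its pre-annihilator: on a set of finite
  measure an annihilated function equals its conditional expectation, and order-closedness of
  \<open>\<Sigma>\<^sub>0\<close> glues the superlevel sets of these local versions.
  For (iii) \<open>\<Longrightarrow>\<close> (ii), against finitely many integrable functions a supremum is the limit of an increasing
  sequence taken from the lattice \<open>N\<^sub>s\<^sub>a\<close>.
  For (ii) \<open>\<Longrightarrow>\<close> (i), \<open>{u > t}\<close> is the supremum of \<open>min 1 (n (u - t)\<^sup>+)\<close>, and the suprema
  of projections in \<open>\<P>(M)\<close> and in \<open>M\<^sub>s\<^sub>a\<close> agree.\<close>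

section \<open>Functions with class in a given set\<close>

text \<open>The obstacle in (iv) \<Longrightarrow> (iii) is that \<mu> restricted to
  \<open>\<Sigma>\<^sub>0\<close> may fail to be semifinite: the trivial \<sigma>-algebra is
  essentially order-closed even over a space of infinite measure. Conditional expectations are
  therefore formed only for \<mu> cut down to a set A of finite measure. The versions for different
  A are related to each other only through u, so the functions are not patched directly; their
  superlevel sets are, each being compared with the one set \<open>{u > t}\<close>. Annihilators are
  used because a common zero set of pairings is weak* closed by the very definition of the topology,
  without a Hahn-Banach argument. In (iii) \<Longrightarrow> (ii) no single sequence has to converge
  to the supremum in the weak* sense: a basic neighbourhood involves finitely many integrable
  functions, and a sequence may be chosen for these alone.\<close>

definition members :: "'a measure \<Rightarrow> 'a class_fun set \<Rightarrow> ('a \<Rightarrow> complex) set" where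
  "members M V = {f \<in> Linf_fun M. cls M f \<in> V}"

text \<open>Sets of functions rather than classes, so that closure properties can be proved with
  pointwise formulas. Membership is stable under a.e. changes among essentially bounded
  functions.\<close>

definition real_members :: "'a measure \<Rightarrow> 'a class_fun set \<Rightarrow> ('a \<Rightarrow> real) set" where
  "real_members M V = {u. (\<lambda>x. complex_of_real (u x)) \<in> members M V}"

definition rcls :: "'a measure \<Rightarrow> ('a \<Rightarrow> real) \<Rightarrow> 'a class_fun" where
  "rcls M u = cls M (\<lambda>x. complex_of_real (u x))"

definition Linf_real :: "'a measure \<Rightarrow> ('a \<Rightarrow> real) set" where
  "Linf_real M = {u \<in> borel_measurable M. \<exists>C. AE x in M. \<bar>u x\<bar> \<le> C}"

lemma membersD: "f \<in> members M V \<Longrightarrow> f \<in> Linf_fun M" "f \<in> members M V \<Longrightarrow> cls M f \<in> V"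
  by (auto simp: members_def)

lemma of_real_Linf_fun_iff: "(\<lambda>x. complex_of_real (u x)) \<in> Linf_fun M \<longleftrightarrow> u \<in> Linf_real M"
  by (auto simp: Linf_fun_def Linf_real_def borel_measurable_complex_iff)

lemma real_members_iff: "u \<in> real_members M V \<longleftrightarrow> u \<in> Linf_real M \<and> rcls M u \<in> V"
  by (auto simp: real_members_def members_def of_real_Linf_fun_iff rcls_def)

lemma Linf_realD [measurable_dest]: "u \<in> Linf_real M \<Longrightarrow> u \<in> borel_measurable M"
  by (simp add: Linf_real_def)

lemma Linf_real_bounded_by:
  assumes "u \<in> borel_measurable M" "AE x in M. \<bar>u x\<bar> \<le> \<bar>v x\<bar>" "v \<in> Linf_real M"
  shows "u \<in> Linf_real M"
proof -
  obtain C where "AE x in M. \<bar>v x\<bar> \<le> C" using assms(3) by (auto simp: Linf_real_def)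
  with assms(2) have "AE x in M. \<bar>u x\<bar> \<le> C" by eventually_elim simp
  with assms(1) show ?thesis by (auto simp: Linf_real_def)
qed

text \<open>Almost all values of u lie in a compact interval [-C, C], on which \<phi> is bounded
  even if it is unbounded on the line.\<close>

lemma Linf_real_continuous:
  assumes "u \<in> Linf_real M" "continuous_on UNIV (\<phi> :: real \<Rightarrow> real)"
  shows "(\<lambda>x. \<phi> (u x)) \<in> Linf_real M"
proof -
  obtain C where C: "AE x in M. \<bar>u x\<bar> \<le> C" using assms(1) by (auto simp: Linf_real_def)
  have "compact (\<phi> ` {-C..C})"
    using assms(2) by (intro compact_continuous_image) (auto intro: continuous_on_subset)
  then obtain B where B: "\<And>y. \<bar>y\<bar> \<le> C \<Longrightarrow> \<bar>\<phi> y\<bar> \<le> B"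
    by (metis abs_le_iff atLeastAtMost_iff bounded_iff compact_imp_bounded image_eqI minus_le_iff
        real_norm_def)
  have "AE x in M. \<bar>\<phi> (u x)\<bar> \<le> B" using C by eventually_elim (rule B)
  moreover have "(\<lambda>x. \<phi> (u x)) \<in> borel_measurable M"
    using borel_measurable_continuous_on[OF assms(2) Linf_realD[OF assms(1)]] .
  ultimately show ?thesis by (auto simp: Linf_real_def)
qed

lemma Re_Linf_real: "f \<in> Linf_fun M \<Longrightarrow> (\<lambda>x. Re (f x)) \<in> Linf_real M"
proof -
  assume f: "f \<in> Linf_fun M"
  then obtain C where C: "AE x in M. norm (f x) \<le> C" by (auto simp: Linf_fun_def)
  then have "AE x in M. \<bar>Re (f x)\<bar> \<le> C"
    by eventually_elim (meson abs_Re_le_cmod order_trans)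
  with f show ?thesis by (auto simp: Linf_real_def Linf_fun_def)
qed

lemma Im_Linf_real: "f \<in> Linf_fun M \<Longrightarrow> (\<lambda>x. Im (f x)) \<in> Linf_real M"
  using Re_Linf_real[OF Linf_fun_scale[of f M "-\<i>"]] by simp

lemma rcls_le_iff:
  assumes "u \<in> Linf_real M" "v \<in> Linf_real M"
  shows "Linf_le M (rcls M u) (rcls M v) \<longleftrightarrow> (AE x in M. u x \<le> v x)"
proof -
  have "complex_of_real b - complex_of_real a \<in> \<real>\<^sub>\<ge>\<^sub>0 \<longleftrightarrow> a \<le> b" for a b
    using nonneg_Reals_of_real_iff[of "b - a", where 'a = complex] by simp
  then show ?thesis
    using assms by (simp add: rcls_def Linf_le_cls of_real_Linf_fun_iff)
qed

lemma rcls_eq_iff: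
  assumes "u \<in> Linf_real M" "v \<in> Linf_real M"
  shows "rcls M u = rcls M v \<longleftrightarrow> (AE x in M. u x = v x)"
  using assms by (simp add: rcls_def cls_eq_iff of_real_Linf_fun_iff)

lemma real_members_cong:
  assumes "u \<in> real_members M V" "v \<in> Linf_real M" "AE x in M. u x = v x"
  shows "v \<in> real_members M V"
  using assms rcls_eq_iff[of u M v] by (simp add: real_members_iff)

lemma rcls_star: "u \<in> Linf_real M \<Longrightarrow> Linf_star M (rcls M u) = rcls M u"
  by (simp add: rcls_def Linf_star_cls of_real_Linf_fun_iff)

text \<open>Selfadjointness makes a representative real only a.e.; its real part represents the same
  class and is real everywhere.\<close>

lemma sa_part_eq:
  assumes "V \<subseteq> Linf M"
  shows "sa_part M V = rcls M ` real_members M V"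
proof (intro equalityI subsetI)
  fix \<phi> assume "\<phi> \<in> sa_part M V"
  then have \<phi>: "\<phi> \<in> V" "Linf_star M \<phi> = \<phi>" by (auto simp: sa_part_def)
  define f where "f = rep \<phi>"
  have f: "f \<in> Linf_fun M" "\<phi> = cls M f" using cls_rep[of \<phi> M] \<phi> assms by (auto simp: f_def)
  then have "cls M (\<lambda>x. cnj (f x)) = cls M f" using \<phi> Linf_star_cls[OF f(1)] by simp
  then have "AE x in M. cnj (f x) = f x" using f(1) by (simp add: cls_eq_iff Linf_fun_cnj)
  then have "AE x in M. f x = complex_of_real (Re (f x))"
    by eventually_elim (auto simp: complex_eq_iff)
  then have "\<phi> = rcls M (\<lambda>x. Re (f x))"
    using f cls_eq_iff[OF f(1), of "\<lambda>x. complex_of_real (Re (f x))"] Re_Linf_real[OF f(1)]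
    by (simp add: rcls_def of_real_Linf_fun_iff)
  then show "\<phi> \<in> rcls M ` real_members M V"
    using \<phi>(1) Re_Linf_real[OF f(1)] by (auto simp: real_members_iff)
next
  fix \<phi> assume "\<phi> \<in> rcls M ` real_members M V"
  then show "\<phi> \<in> sa_part M V" by (auto simp: sa_part_def real_members_iff rcls_star)
qed

lemma real_members_Linf: "real_members M (Linf M) = Linf_real M"
  by (auto simp: real_members_iff rcls_def intro!: cls_in_Linf simp: of_real_Linf_fun_iff)

section \<open>Norm and norm closure in terms of functions\<close>

lemma Linf_norm_le:
  assumes "f \<in> Linf_fun M" "AE x in M. norm (f x) \<le> C" "0 \<le> C"
  shows "Linf_norm M (cls M f) \<le> C"
proof -
  have [measurable]: "f \<in> borel_measurable M" using assms by (auto simp: Linf_fun_def)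
  have "AE x in M. ennreal (norm (f x)) \<le> ennreal C"
    using assms(2) by eventually_elim (simp add: ennreal_leI)
  then have "esssup M (\<lambda>x. ennreal (norm (f x))) \<le> ennreal C" by (intro esssup_I) auto
  then show ?thesis
    using assms(3) by (simp add: Linf_norm_cls[OF assms(1)] enn2real_leI)
qed

lemma Linf_norm_AE:
  assumes "f \<in> Linf_fun M"
  shows "AE x in M. norm (f x) \<le> Linf_norm M (cls M f)"
proof -
  have [measurable]: "f \<in> borel_measurable M" using assms by (auto simp: Linf_fun_def)
  obtain C where C: "AE x in M. norm (f x) \<le> C" using assms by (auto simp: Linf_fun_def)
  then have "AE x in M. ennreal (norm (f x)) \<le> ennreal C"
    by eventually_elim (simp add: ennreal_leI)
  then have "esssup M (\<lambda>x. ennreal (norm (f x))) \<le> ennreal C" by (intro esssup_I) auto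
  \<comment> \<open>\<open>enn2real\<close> sends \<infinity> to 0, so the passage to reals
    preserves the bound only because the essential supremum is finite.\<close>
  then have fin: "esssup M (\<lambda>x. ennreal (norm (f x))) < top"
    using ennreal_less_top order_le_less_trans by blast
  show ?thesis
    using esssup_AE[of "\<lambda>x. ennreal (norm (f x))" M]
  proof eventually_elim
    case (elim x)
    then have "enn2real (ennreal (norm (f x))) \<le> enn2real (esssup M (\<lambda>x. ennreal (norm (f x))))"
      using fin by (intro enn2real_mono) auto
    then show ?case by (simp add: Linf_norm_cls[OF assms])
  qed
qed

lemma norm_closureI:
  assumes "V \<subseteq> Linf M" "f \<in> Linf_fun M"
    and "\<And>e. e > 0 \<Longrightarrow> \<exists>g\<in>members M V. AE x in M. norm (f x - g x) \<le> e"
  shows "cls M f \<in> norm_closure M V"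
  unfolding norm_closure_def
proof (intro CollectI conjI allI impI)
  show "cls M f \<in> Linf M" by (rule cls_in_Linf[OF assms(2)])
  fix e :: real assume "e > 0"
  \<comment> \<open>Half of e turns the non-strict a.e. bound into the strict inequality in
    \<open>norm_closure\<close>.\<close>
  then obtain g where g: "g \<in> members M V" "AE x in M. norm (f x - g x) \<le> e / 2"
    using assms(3)[of "e / 2"] by auto
  note gL = membersD[OF g(1)]
  have "Linf_norm M (cls M (\<lambda>x. f x - g x)) \<le> e / 2"
    using \<open>e > 0\<close> g by (intro Linf_norm_le Linf_fun_diff assms(2) gL) auto
  then have "Linf_norm M (Linf_diff M (cls M f) (cls M g)) < e"
    using \<open>e > 0\<close> by (simp add: Linf_diff_cls[OF assms(2) gL(1)])
  then show "\<exists>\<psi>\<in>V. Linf_norm M (Linf_diff M (cls M f) \<psi>) < e" using gL by blast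
qed

lemma norm_closureD:
  assumes "V \<subseteq> Linf M" "f \<in> Linf_fun M" "cls M f \<in> norm_closure M V" "e > 0"
  shows "\<exists>g\<in>members M V. AE x in M. norm (f x - g x) \<le> e"
proof -
  obtain \<psi> where \<psi>: "\<psi> \<in> V" "Linf_norm M (Linf_diff M (cls M f) \<psi>) < e"
    using assms(3,4) by (auto simp: norm_closure_def)
  define g where "g = rep \<psi>"
  have g: "g \<in> Linf_fun M" "\<psi> = cls M g" using cls_rep[of \<psi> M] \<psi> assms(1) by (auto simp: g_def)
  have "AE x in M. norm (f x - g x) \<le> e"
    using Linf_norm_AE[OF Linf_fun_diff[OF assms(2) g(1)]] \<psi>(2)
    by (auto simp: g Linf_diff_cls[OF assms(2) g(1)] elim!: eventually_mono)
  then show ?thesis using g \<psi>(1) by (auto simp: members_def)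
qed

lemma norm_closure_mono: "S \<subseteq> T \<Longrightarrow> norm_closure M S \<subseteq> norm_closure M T"
  unfolding norm_closure_def by blast

text \<open>A locale for subspaces that carries no norm closedness: it is instantiated with the
  subalgebra and also with the linear span of its projections.\<close>

locale linf_subspace =
  fixes M :: "'a measure" and V :: "'a class_fun set"
  assumes subspace: "Linf_subspace M V"
begin

lemma sub_Linf: "V \<subseteq> Linf M"
  using subspace by (simp add: Linf_subspace_def)

lemma members_zero: "(\<lambda>_. 0) \<in> members M V"
  using subspace by (simp add: Linf_subspace_def members_def Linf_fun_const Linf_zero_def)

lemma members_add:
  assumes "f \<in> members M V" "g \<in> members M V"
  shows "(\<lambda>x. f x + g x) \<in> members M V"
proof -
  note L = membersD[OF assms(1)] membersD[OF assms(2)]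
  have "Linf_add M (cls M f) (cls M g) \<in> V"
    using subspace L by (simp add: Linf_subspace_def)
  then show ?thesis using L by (simp add: members_def Linf_fun_add Linf_add_cls)
qed

lemma members_scale:
  assumes "f \<in> members M V"
  shows "(\<lambda>x. c * f x) \<in> members M V"
proof -
  note L = membersD[OF assms]
  have "Linf_scale M c (cls M f) \<in> V"
    using subspace L by (simp add: Linf_subspace_def)
  then show ?thesis using L by (simp add: members_def Linf_fun_scale Linf_scale_cls)
qed

lemma members_sum:
  assumes "\<And>i. i \<in> I \<Longrightarrow> f i \<in> members M V"
  shows "(\<lambda>x. \<Sum>i\<in>I. f i x) \<in> members M V"
proof (cases "finite I")
  case True
  from this assms show ?thesis
  proof (induction I)
    case empty
    then show ?case by (simp add: members_zero)
  next
    case (insert i I)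
    then show ?case using members_add[of "f i" "\<lambda>x. \<Sum>i\<in>I. f i x"] by auto
  qed
qed (simp add: members_zero)

lemma real_members_add:
  "u \<in> real_members M V \<Longrightarrow> v \<in> real_members M V \<Longrightarrow> (\<lambda>x. u x + v x) \<in> real_members M V"
  using members_add[of "\<lambda>x. complex_of_real (u x)" "\<lambda>x. complex_of_real (v x)"]
  by (simp add: real_members_def)

lemma real_members_scale:
  "u \<in> real_members M V \<Longrightarrow> (\<lambda>x. c * u x) \<in> real_members M V"
  using members_scale[of "\<lambda>x. complex_of_real (u x)" "complex_of_real c"]
  by (simp add: real_members_def)

lemma real_members_sum:
  "(\<And>i. i \<in> I \<Longrightarrow> f i \<in> real_members M V) \<Longrightarrow> (\<lambda>x. \<Sum>i\<in>I. f i x) \<in> real_members M V"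
  using members_sum[of I "\<lambda>i x. complex_of_real (f i x)"] by (simp add: real_members_def)

lemma members_cartesian:
  assumes "(\<lambda>x. Re (f x)) \<in> real_members M V" "(\<lambda>x. Im (f x)) \<in> real_members M V"
  shows "f \<in> members M V"
proof -
  have "(\<lambda>x. complex_of_real (Re (f x)) + \<i> * complex_of_real (Im (f x))) \<in> members M V"
    using assms by (intro members_add members_scale) (auto simp: real_members_def)
  then show ?thesis by (simp add: complex_eq[symmetric])
qed

text \<open>Rounding u up to the grid of mesh e gives \<open>e * \<lceil>u / e\<rceil>\<close>,
  which differs from u by at most e. Counting the grid points below u writes it as a linear
  combination of superlevel indicators and 1, so it lies in V.\<close>

lemma spectral_approximation:
  assumes u: "u \<in> Linf_real M"
    and one: "(\<lambda>_. 1) \<in> real_members M V"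
    and spec: "\<And>t. indicator {x \<in> space M. t < u x} \<in> real_members M V"
  shows "rcls M u \<in> norm_closure M V"
  unfolding rcls_def
proof (rule norm_closureI[OF sub_Linf])
  show "(\<lambda>x. complex_of_real (u x)) \<in> Linf_fun M" using u by (simp add: of_real_Linf_fun_iff)
  fix e :: real assume "e > 0"
  obtain C where C: "AE x in M. \<bar>u x\<bar> \<le> C" using u by (auto simp: Linf_real_def)
  \<comment> \<open>Almost everywhere \<open>- m \<le> \<lceil>u x / e\<rceil> \<le> m\<close>, so
    the sum over \<open>{-m..<m}\<close> counts exactly \<open>\<lceil>u x / e\<rceil> + m\<close>
    indices; the constant term removes the offset m.\<close>
  define m where "m = \<lceil>C / e\<rceil>"
  define s where "s x = e * ((- real_of_int m) * 1 +
      (\<Sum>k\<in>{-m..<m}. indicator {x \<in> space M. e * real_of_int k < u x} x))" for x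
  have "s \<in> real_members M V"
    unfolding s_def
    by (intro real_members_scale real_members_add real_members_sum one spec)
  moreover have "AE x in M. \<bar>u x - s x\<bar> \<le> e"
    using C AE_space
  proof eventually_elim
    case (elim x)
    have "\<bar>u x / e\<bar> \<le> real_of_int m"
      using elim \<open>e > 0\<close>
      by (simp add: m_def) (meson divide_right_mono le_of_int_ceiling less_imp_le order_trans)
    then have m: "-m \<le> \<lceil>u x / e\<rceil>" "\<lceil>u x / e\<rceil> \<le> m" by linarith+
    have "(\<Sum>k\<in>{-m..<m}. indicator {x \<in> space M. e * real_of_int k < u x} x)
        = (\<Sum>k\<in>{-m..<m}. if k < \<lceil>u x / e\<rceil> then 1 else (0::real))"
      using elim \<open>e > 0\<close>
      by (intro sum.cong) (auto simp: indicator_def less_ceiling_iff pos_less_divide_eq mult.commute)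
    also have "\<dots> = (\<Sum>k\<in>{-m..<\<lceil>u x / e\<rceil>}. 1)"
      using m by (intro sum.mono_neutral_cong_right) auto
    also have "\<dots> = real_of_int (\<lceil>u x / e\<rceil> + m)" using m by simp
    finally have "s x = e * real_of_int \<lceil>u x / e\<rceil>" by (simp add: s_def)
    moreover have "u x - e * c = e * (u x / e - c)" for c using \<open>e > 0\<close> by (simp add: field_simps)
    moreover have "\<bar>u x / e - real_of_int \<lceil>u x / e\<rceil>\<bar> \<le> 1" by linarith
    then have "e * \<bar>u x / e - real_of_int \<lceil>u x / e\<rceil>\<bar> \<le> e"
      using \<open>e > 0\<close> by (intro mult_left_le) auto
    ultimately show ?case using \<open>e > 0\<close> by (simp add: abs_mult)
  qed
  ultimately show "\<exists>g\<in>members M V. AE x in M. norm (complex_of_real (u x) - g x) \<le> e"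
    by (intro bexI[of _ "\<lambda>x. complex_of_real (s x)"])
       (auto simp: real_members_def of_real_diff[symmetric] simp del: of_real_diff)
qed

end

section \<open>Functional calculus and lattice operations in a unital subalgebra\<close>

locale linf_subalgebra =
  fixes M :: "'a measure" and N :: "'a class_fun set"
  assumes subalgebra: "unital_cstar_subalgebra M N"

sublocale linf_subalgebra \<subseteq> linf_subspace M N
  using subalgebra by unfold_locales (simp add: unital_cstar_subalgebra_def)

context linf_subalgebra
begin

lemma members_const: "(\<lambda>_. c) \<in> members M N"
proof -
  have "(\<lambda>_. 1) \<in> members M N"
    using subalgebra by (simp add: unital_cstar_subalgebra_def members_def Linf_one_def Linf_fun_const)
  from members_scale[OF this, of c] show ?thesis by simp
qed

lemma members_mult:
  assumes "f \<in> members M N" "g \<in> members M N"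
  shows "(\<lambda>x. f x * g x) \<in> members M N"
proof -
  note L = membersD[OF assms(1)] membersD[OF assms(2)]
  have "Linf_mult M (cls M f) (cls M g) \<in> N"
    using subalgebra L by (simp add: unital_cstar_subalgebra_def)
  then show ?thesis using L by (simp add: members_def Linf_fun_mult Linf_mult_cls)
qed

lemma members_cnj:
  assumes "f \<in> members M N"
  shows "(\<lambda>x. cnj (f x)) \<in> members M N"
proof -
  note L = membersD[OF assms]
  have "Linf_star M (cls M f) \<in> N"
    using subalgebra L by (simp add: unital_cstar_subalgebra_def)
  then show ?thesis using L by (simp add: members_def Linf_fun_cnj Linf_star_cls)
qed

lemma members_Re: "f \<in> members M N \<Longrightarrow> (\<lambda>x. Re (f x)) \<in> real_members M N"
proof -
  assume f: "f \<in> members M N"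
  have "(\<lambda>x. 1 / 2 * (f x + cnj (f x))) \<in> members M N"
    by (intro members_scale members_add members_cnj f)
  moreover have "1 / 2 * (f x + cnj (f x)) = complex_of_real (Re (f x))" for x
    by (simp add: complex_eq_iff)
  ultimately show ?thesis by (simp add: real_members_def)
qed

lemma members_Im: "f \<in> members M N \<Longrightarrow> (\<lambda>x. Im (f x)) \<in> real_members M N"
  using members_Re[OF members_scale[of f "-\<i>"]] by simp

lemma real_members_const: "(\<lambda>_. c) \<in> real_members M N"
  using members_const by (simp add: real_members_def)

lemma real_members_mult:
  "u \<in> real_members M N \<Longrightarrow> v \<in> real_members M N \<Longrightarrow> (\<lambda>x. u x * v x) \<in> real_members M N"
  using members_mult[of "\<lambda>x. complex_of_real (u x)" "\<lambda>x. complex_of_real (v x)"]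
  by (simp add: real_members_def)

lemma norm_closure_sub: "norm_closure M N \<subseteq> N"
  using subalgebra by (simp add: unital_cstar_subalgebra_def)

lemma real_members_spectral:
  assumes "u \<in> Linf_real M" "\<And>t. indicator {x \<in> space M. t < u x} \<in> real_members M N"
  shows "u \<in> real_members M N"
  using subsetD[OF norm_closure_sub spectral_approximation[OF assms(1) real_members_const assms(2)]]
    assms(1) by (simp add: real_members_iff)

text \<open>Polynomials in u stay in the algebra. On an interval [-C, C] carrying almost all values
  of u they approximate \<phi> uniformly, by Weierstrass, and N is norm closed.\<close>

lemma real_members_continuous:
  assumes u: "u \<in> real_members M N" and \<phi>: "continuous_on UNIV (\<phi> :: real \<Rightarrow> real)"
  shows "(\<lambda>x. \<phi> (u x)) \<in> real_members M N"
proof -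
  have uL: "u \<in> Linf_real M" using u by (simp add: real_members_iff)
  have poly: "(\<lambda>x. p (u x)) \<in> real_members M N" if "real_polynomial_function p" for p
    using that
  proof (induction p)
    case (linear f)
    then obtain c where "f = (\<lambda>x. x * c)" by (rule real_bounded_linear[THEN iffD1, THEN exE])
    then show ?case using real_members_scale[OF u, of c] by (simp add: mult.commute)
  qed (auto intro: real_members_const real_members_add real_members_mult)
  obtain C where C: "AE x in M. \<bar>u x\<bar> \<le> C" using uL by (auto simp: Linf_real_def)
  have "rcls M (\<lambda>x. \<phi> (u x)) \<in> norm_closure M N"
    unfolding rcls_def
  proof (rule norm_closureI[OF sub_Linf])
    show "(\<lambda>x. complex_of_real (\<phi> (u x))) \<in> Linf_fun M"
      using Linf_real_continuous[OF uL \<phi>] by (simp add: of_real_Linf_fun_iff)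
    fix e :: real assume "e > 0"
    obtain p where p: "real_polynomial_function p" "\<And>y. y \<in> {-C..C} \<Longrightarrow> \<bar>\<phi> y - p y\<bar> < e"
      using Stone_Weierstrass_real_polynomial_function[OF compact_Icc[of "-C" C] continuous_on_subset[OF \<phi>] \<open>e > 0\<close>]
      by auto
    have "AE x in M. \<bar>\<phi> (u x) - p (u x)\<bar> \<le> e"
      using C by eventually_elim (intro less_imp_le p(2), auto)
    then show "\<exists>g\<in>members M N. AE x in M. norm (complex_of_real (\<phi> (u x)) - g x) \<le> e"
      using poly[OF p(1)]
      by (intro bexI[of _ "\<lambda>x. complex_of_real (p (u x))"])
         (auto simp: real_members_def of_real_diff[symmetric] simp del: of_real_diff)
  qed
  then show ?thesis
    using norm_closure_sub Linf_real_continuous[OF uL \<phi>] by (auto simp: real_members_iff)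
qed

lemma real_members_max:
  assumes "u \<in> real_members M N" "v \<in> real_members M N"
  shows "(\<lambda>x. max (u x) (v x)) \<in> real_members M N"
proof -
  \<comment> \<open>The maximum of two functions is reduced to the one-variable function
    \<open>max 0\<close>, to which the functional calculus applies.\<close>
  have "(\<lambda>x. u x + max 0 (v x + (-1) * u x)) \<in> real_members M N"
    using assms
    by (intro real_members_add real_members_scale real_members_continuous[where \<phi> = "max 0"]
        continuous_intros)
  moreover have "u x + max 0 (v x + (-1) * u x) = max (u x) (v x)" for x by (auto simp: max_def)
  ultimately show ?thesis by simp
qed

end

section \<open>Projections and essential unions\<close>

definition proj_sets :: "'a measure \<Rightarrow> 'a class_fun set \<Rightarrow> 'a set set" where
  "proj_sets M V = {E \<in> sets M. cls M (indicator E) \<in> V}"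

abbreviation ae_subset :: "'a measure \<Rightarrow> 'a set \<Rightarrow> 'a set \<Rightarrow> bool" where
  "ae_subset M E G \<equiv> (AE x in M. x \<in> E \<longrightarrow> x \<in> G)"

text \<open>The supremum in the measure algebra. Each E has its own exceptional null set, so for an
  uncountable family H may differ essentially from the set-theoretic union.\<close>

definition is_ess_union :: "'a measure \<Rightarrow> 'a set set \<Rightarrow> 'a set \<Rightarrow> bool" where
  "is_ess_union M \<E> H \<longleftrightarrow> H \<in> sets M \<and> (\<forall>E\<in>\<E>. ae_subset M E H) \<and>
     (\<forall>U\<in>sets M. (\<forall>E\<in>\<E>. ae_subset M E U) \<longrightarrow> ae_subset M H U)"

lemma rcls_indicator: "rcls M (indicator E) = cls M (indicator E)"
  unfolding rcls_def by (rule arg_cong[of _ _ "cls M"]) (auto simp: indicator_def)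

lemma indicator_Linf_real: "E \<in> sets M \<Longrightarrow> indicator E \<in> Linf_real M"
  unfolding Linf_real_def by (auto intro!: exI[of _ 1])

lemma indicator_real_members_iff:
  "E \<in> sets M \<Longrightarrow> indicator E \<in> real_members M V \<longleftrightarrow> E \<in> proj_sets M V"
  by (simp add: real_members_iff indicator_Linf_real rcls_indicator proj_sets_def)

lemma cls_indicator_le_iff:
  assumes "E \<in> sets M" "G \<in> sets M"
  shows "Linf_le M (cls M (indicator E)) (cls M (indicator G)) \<longleftrightarrow> ae_subset M E G"
proof -
  have "Linf_le M (cls M (indicator E)) (cls M (indicator G))
      \<longleftrightarrow> (AE x in M. indicator E x \<le> (indicator G x :: real))"
    using rcls_le_iff[OF assms[THEN indicator_Linf_real]] by (simp add: rcls_indicator)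
  also have "\<dots> \<longleftrightarrow> ae_subset M E G"
    by (rule eventually_cong[OF eventually_True]) (simp add: indicator_def)
  finally show ?thesis .
qed

lemma projections_eq:
  assumes "V \<subseteq> Linf M"
  shows "projections M V = (\<lambda>E. cls M (indicator E)) ` proj_sets M V"
proof -
  have "projections M V = projections M (Linf M) \<inter> V" using assms by (auto simp: projections_def)
  then show ?thesis unfolding projections_Linf proj_sets_def by auto
qed

lemma proj_sets_Linf: "proj_sets M (Linf M) = sets M"
  by (auto simp: proj_sets_def intro: cls_in_Linf Linf_fun_indicator)

lemma is_supremum_projections_iff:
  assumes "\<E> \<subseteq> sets M" "H \<in> sets M"
  shows "is_supremum M (projections M (Linf M)) ((\<lambda>E. cls M (indicator E)) ` \<E>) (cls M (indicator H))
    \<longleftrightarrow> is_ess_union M \<E> H"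
proof -
  have "E \<in> sets M" if "E \<in> \<E>" for E using assms(1) that by blast
  then show ?thesis
    using assms(2)
    by (simp add: is_supremum_def is_ess_union_def projections_eq[OF order_refl] proj_sets_Linf
        cls_indicator_le_iff)
qed

text \<open>The net is indexed by its own set of classes, because \<open>localizable\<close> and
  \<open>projections_order_closed\<close> take their index sets from the type of classes.\<close>

lemma directed_net:
  assumes "\<E> \<subseteq> sets M" "\<E> \<noteq> {}" "\<And>E G. E \<in> \<E> \<Longrightarrow> G \<in> \<E> \<Longrightarrow> E \<union> G \<in> \<E>"
    and "(\<lambda>E. cls M (indicator E)) ` \<E> \<subseteq> P"
  shows "increasing_net M P ((\<lambda>E. cls M (indicator E)) ` \<E>) (Linf_le M) (\<lambda>\<phi>. \<phi>)"
  unfolding increasing_net_def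
proof (intro conjI ballI impI)
  let ?p = "\<lambda>E. cls M (indicator E)"
  show "?p ` \<E> \<noteq> {}" using assms by simp
  show "reflp_on (?p ` \<E>) (Linf_le M)" by (auto simp: reflp_on_def Linf_le_def)
  show "transp_on (?p ` \<E>) (Linf_le M)"
    unfolding transp_on_def
  proof safe
    fix A B C assume *: "A \<in> \<E>" "B \<in> \<E>" "C \<in> \<E>" "Linf_le M (?p A) (?p B)" "Linf_le M (?p B) (?p C)"
    then have "A \<in> sets M" "B \<in> sets M" "C \<in> sets M" using assms(1) by auto
    with *(4,5) have "ae_subset M A B" "ae_subset M B C" by (simp_all add: cls_indicator_le_iff)
    then have "ae_subset M A C" by eventually_elim blast
    then show "Linf_le M (?p A) (?p C)"
      using \<open>A \<in> sets M\<close> \<open>C \<in> sets M\<close> by (simp add: cls_indicator_le_iff)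
  qed
  show "(\<lambda>\<phi>. \<phi>) \<in> ?p ` \<E> \<rightarrow> P" using assms(4) by blast
  fix i j assume "i \<in> ?p ` \<E>" "j \<in> ?p ` \<E>"
  then obtain A B where AB: "A \<in> \<E>" "B \<in> \<E>" "i = ?p A" "j = ?p B" by blast
  moreover have "A \<union> B \<in> \<E>" using assms(3) AB by blast
  moreover have "A \<in> sets M" "B \<in> sets M" using assms(1) AB by auto
  ultimately show "\<exists>k\<in>?p ` \<E>. Linf_le M i k \<and> Linf_le M j k"
    by (intro bexI[of _ "?p (A \<union> B)"]) (auto simp: cls_indicator_le_iff)
qed simp

text \<open>Enlarging a family of sets inside a lattice to all sets below its upper bounds makes it
  directed without changing its essential union.\<close>

definition lower_hull :: "'a measure \<Rightarrow> 'a set set \<Rightarrow> 'a set set \<Rightarrow> 'a set set" where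
  "lower_hull M \<A> \<E> = {E \<in> \<A>. \<forall>U\<in>sets M. (\<forall>G\<in>\<E>. ae_subset M G U) \<longrightarrow> ae_subset M E U}"

lemma is_ess_union_lower_hull:
  assumes "\<E> \<subseteq> \<A>"
  shows "is_ess_union M (lower_hull M \<A> \<E>) H \<longleftrightarrow> is_ess_union M \<E> H"
proof -
  have "\<E> \<subseteq> lower_hull M \<A> \<E>" using assms by (auto simp: lower_hull_def)
  then have "(\<forall>E\<in>lower_hull M \<A> \<E>. ae_subset M E U) \<longleftrightarrow> (\<forall>E\<in>\<E>. ae_subset M E U)"
    if "U \<in> sets M" for U using that unfolding lower_hull_def by blast
  then show ?thesis by (auto simp: is_ess_union_def)
qed

lemma lower_hull_Un:
  assumes "\<And>E G. E \<in> \<A> \<Longrightarrow> G \<in> \<A> \<Longrightarrow> E \<union> G \<in> \<A>"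
    and "E \<in> lower_hull M \<A> \<E>" "G \<in> lower_hull M \<A> \<E>"
  shows "E \<union> G \<in> lower_hull M \<A> \<E>"
  unfolding lower_hull_def
proof (intro CollectI conjI ballI impI)
  show "E \<union> G \<in> \<A>" using assms by (simp add: lower_hull_def)
  fix U assume "U \<in> sets M" "\<forall>G\<in>\<E>. ae_subset M G U"
  then have "ae_subset M E U" "ae_subset M G U" using assms(2,3) by (simp_all add: lower_hull_def)
  then show "ae_subset M (E \<union> G) U" by eventually_elim blast
qed

lemma lower_hull_net:
  assumes "\<A> \<subseteq> sets M" "{} \<in> \<A>" "\<And>E G. E \<in> \<A> \<Longrightarrow> G \<in> \<A> \<Longrightarrow> E \<union> G \<in> \<A>"
    and "(\<lambda>E. cls M (indicator E)) ` \<A> \<subseteq> P"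
  shows "increasing_net M P ((\<lambda>E. cls M (indicator E)) ` lower_hull M \<A> \<E>) (Linf_le M) (\<lambda>\<phi>. \<phi>)"
proof (rule directed_net)
  have sub: "lower_hull M \<A> \<E> \<subseteq> \<A>" by (auto simp: lower_hull_def)
  then show "lower_hull M \<A> \<E> \<subseteq> sets M"
    "(\<lambda>E. cls M (indicator E)) ` lower_hull M \<A> \<E> \<subseteq> P" using assms(1,4) by blast+
  have "{} \<in> lower_hull M \<A> \<E>" unfolding lower_hull_def using assms(2) by simp
  then show "lower_hull M \<A> \<E> \<noteq> {}" by blast
qed (rule lower_hull_Un[OF assms(3)])

text \<open>Localizability provides suprema of nets only; an arbitrary family becomes a net through
  its lower hull in all of \<open>sets M\<close>.\<close>

lemma ess_union_exists:
  assumes "localizable M" "\<E> \<subseteq> sets M"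
  shows "\<exists>H. is_ess_union M \<E> H"
proof -
  let ?I = "(\<lambda>E. cls M (indicator E)) ` lower_hull M (sets M) \<E>"
  have "increasing_net M (projections M (Linf M)) ?I (Linf_le M) (\<lambda>\<phi>. \<phi>)"
    by (rule lower_hull_net) (auto simp: projections_eq proj_sets_Linf)
  then obtain s where s: "is_supremum M (projections M (Linf M)) ?I s"
    using assms(1) unfolding localizable_def by (metis image_ident)
  then obtain H where "s = cls M (indicator H)" "H \<in> sets M"
    by (auto simp: is_supremum_def projections_eq proj_sets_Linf)
  with s have "is_ess_union M (lower_hull M (sets M) \<E>) H"
    using is_supremum_projections_iff[of "lower_hull M (sets M) \<E>" M H] by (auto simp: lower_hull_def)
  then show ?thesis using is_ess_union_lower_hull[OF assms(2)] by blast
qed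

text \<open>Countably many exceptional null sets merge into one, so here the ordinary union serves.
  This is the source of the countable unions in \<open>\<Sigma>\<^sub>0\<close>.\<close>

lemma is_ess_union_UN:
  fixes A :: "nat \<Rightarrow> 'a set"
  assumes "range A \<subseteq> sets M"
  shows "is_ess_union M (range A) (\<Union>i. A i)"
  unfolding is_ess_union_def
proof (intro conjI ballI impI)
  show "(\<Union>i. A i) \<in> sets M" using assms by (intro sets.countable_UN) auto
  show "ae_subset M E (\<Union>i. A i)" if "E \<in> range A" for E using that by auto
  fix U assume "\<forall>E\<in>range A. ae_subset M E U"
  then have "AE x in M. \<forall>i. x \<in> A i \<longrightarrow> x \<in> U" unfolding AE_all_countable by blast
  then show "ae_subset M (\<Union>i. A i) U" by eventually_elim blast
qed

section \<open>The Boolean algebra of sets whose projections lie in N\<close>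

context linf_subalgebra
begin

lemma proj_sets_sets: "proj_sets M N \<subseteq> sets M"
  by (auto simp: proj_sets_def)

lemma proj_sets_empty: "{} \<in> proj_sets M N"
  using indicator_real_members_iff[of "{}" M N] real_members_const[of 0]
  by (simp add: indicator_def[abs_def])

lemma proj_sets_Int:
  assumes "A \<in> proj_sets M N" "B \<in> proj_sets M N"
  shows "A \<inter> B \<in> proj_sets M N"
proof -
  have [simp]: "A \<in> sets M" "B \<in> sets M" using assms proj_sets_sets by auto
  have "(\<lambda>x. indicator A x * indicator B x) \<in> real_members M N"
    using assms by (intro real_members_mult) (auto simp: indicator_real_members_iff)
  also have "(\<lambda>x. indicator A x * indicator B x :: real) = indicator (A \<inter> B)"
    by (auto simp: indicator_def)
  finally show ?thesis using indicator_real_members_iff[of "A \<inter> B" M N] sets.Int[of A M B] by simp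
qed

lemma proj_sets_Compl:
  assumes "A \<in> proj_sets M N"
  shows "space M - A \<in> proj_sets M N"
proof -
  have [simp]: "A \<in> sets M" using assms proj_sets_sets by auto
  have "(\<lambda>x. 1 + (-1) * indicator A x) \<in> real_members M N"
    using assms
    by (intro real_members_add real_members_scale real_members_const) (auto simp: indicator_real_members_iff)
  then have "indicator (space M - A) \<in> real_members M N"
    by (rule real_members_cong) (auto intro!: indicator_Linf_real AE_I2 simp: indicator_def)
  then show ?thesis using indicator_real_members_iff[of "space M - A" M N] sets.compl_sets[of A M] by simp
qed

lemma proj_sets_Un:
  assumes "A \<in> proj_sets M N" "B \<in> proj_sets M N"
  shows "A \<union> B \<in> proj_sets M N"
proof -
  have "A \<subseteq> space M" "B \<subseteq> space M" using assms proj_sets_sets sets.sets_into_space by blast+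
  then have "A \<union> B = space M - ((space M - A) \<inter> (space M - B))" by blast
  then show ?thesis using assms by (metis proj_sets_Int proj_sets_Compl)
qed

text \<open>The lower hull is taken inside \<open>proj_sets M N\<close>, which is closed under
  finite unions. It yields a net of projections of N with the same supremum as \<E>, so closedness
  under nets gives closedness under arbitrary families.\<close>

lemma proj_sets_ess_union:
  assumes "projections_order_closed M N" "\<E> \<subseteq> proj_sets M N" "is_ess_union M \<E> H"
  shows "H \<in> proj_sets M N"
proof -
  let ?I = "(\<lambda>E. cls M (indicator E)) ` lower_hull M (proj_sets M N) \<E>"
  have "increasing_net M (projections M N) ?I (Linf_le M) (\<lambda>\<phi>. \<phi>)"
    using proj_sets_sets proj_sets_empty proj_sets_Un
    by (intro lower_hull_net) (auto simp: projections_eq[OF sub_Linf])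
  moreover have H: "H \<in> sets M" using assms(3) by (simp add: is_ess_union_def)
  have "is_supremum M (projections M (Linf M)) ((\<lambda>\<phi>. \<phi>) ` ?I) (cls M (indicator H))"
    using is_supremum_projections_iff[of "lower_hull M (proj_sets M N) \<E>" M H]
      is_ess_union_lower_hull[OF assms(2)] assms(3) proj_sets_sets H
    by (simp only: image_ident) (auto simp: lower_hull_def)
  ultimately have "cls M (indicator H) \<in> projections M N"
    using assms(1) unfolding projections_order_closed_def by blast
  then show ?thesis using H by (simp add: projections_def proj_sets_def)
qed

end

section \<open>Functions measurable with respect to a sub-sigma-algebra\<close>

text \<open>\<open>Linf_sub\<close> asks for boundedness everywhere on the space, while an
  F-measurable version of f is bounded only a.e. Truncation at the essential bound keeps
  F-measurability and alters the version on a null set only.\<close>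

lemma members_Linf_sub_iff:
  assumes F: "subalgebra M F"
  shows "f \<in> members M (Linf_sub M F) \<longleftrightarrow>
    f \<in> Linf_fun M \<and> (\<exists>g\<in>borel_measurable F. AE x in M. f x = g x)"
proof safe
  assume f: "f \<in> members M (Linf_sub M F)"
  then show fL: "f \<in> Linf_fun M" by (rule membersD)
  obtain g where g: "cls M f = cls M g" "g \<in> borel_measurable F" "bounded (g ` space M)"
    using membersD(2)[OF f] by (auto simp: Linf_sub_def)
  obtain C where "\<forall>x\<in>space M. norm (g x) \<le> C" using g(3) by (auto simp: bounded_iff)
  then have "g \<in> Linf_fun M"
    using measurable_from_subalg[OF F g(2)] by (auto simp: Linf_fun_def intro!: AE_I2)
  then show "\<exists>g\<in>borel_measurable F. AE x in M. f x = g x" using g fL cls_eq_iff by blast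
next
  fix g :: "'a \<Rightarrow> complex"
  assume f: "f \<in> Linf_fun M" and g[measurable]: "g \<in> borel_measurable F" and eq: "AE x in M. f x = g x"
  obtain C where C: "AE x in M. norm (f x) \<le> C" using f by (auto simp: Linf_fun_def)
  define h where "h x = (if norm (g x) \<le> C then g x else 0)" for x
  have h: "h \<in> borel_measurable F" unfolding h_def by measurable
  \<comment> \<open>The absolute value covers a negative C, which can occur over a null space, where
    every a.e. bound holds.\<close>
  have hC: "norm (h x) \<le> \<bar>C\<bar>" for x by (auto simp: h_def)
  then have "h \<in> Linf_fun M" using measurable_from_subalg[OF F h] by (auto simp: Linf_fun_def)
  moreover have "AE x in M. f x = h x" using C eq by eventually_elim (simp add: h_def)
  ultimately have "cls M f = cls M h" using f cls_eq_iff by blast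
  moreover have "bounded (h ` space M)" using hC by (auto simp: bounded_iff)
  ultimately show "f \<in> members M (Linf_sub M F)" using f h by (auto simp: members_def Linf_sub_def)
qed

lemma members_Linf_subI:
  assumes "subalgebra M F" "f \<in> Linf_fun M" "g \<in> borel_measurable F" "AE x in M. f x = g x"
  shows "f \<in> members M (Linf_sub M F)"
  using assms members_Linf_sub_iff by blast

lemma Linf_sub_Linf:
  assumes F: "subalgebra M F"
  shows "Linf_sub M F \<subseteq> Linf M"
proof
  fix \<phi> assume "\<phi> \<in> Linf_sub M F"
  then obtain g where g: "\<phi> = cls M g" "g \<in> borel_measurable F" "bounded (g ` space M)"
    by (auto simp: Linf_sub_def)
  obtain C where "\<forall>x\<in>space M. norm (g x) \<le> C" using g(3) by (auto simp: bounded_iff)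
  then have "g \<in> Linf_fun M"
    using measurable_from_subalg[OF F g(2)] by (auto simp: Linf_fun_def intro!: AE_I2)
  then show "\<phi> \<in> Linf M" using g(1) cls_in_Linf by blast
qed

lemma mem_iff_members:
  assumes "V \<subseteq> Linf M" shows "\<phi> \<in> V \<longleftrightarrow> (\<exists>f\<in>members M V. \<phi> = cls M f)"
proof
  assume "\<phi> \<in> V"
  then have "rep \<phi> \<in> members M V" "\<phi> = cls M (rep \<phi>)"
    using assms cls_rep[of \<phi> M] by (auto simp: members_def)
  then show "\<exists>f\<in>members M V. \<phi> = cls M f" by blast
qed (auto dest: membersD)

lemma Linf_subspace_Linf_sub:
  assumes F: "subalgebra M F"
  shows "Linf_subspace M (Linf_sub M F)"
proof -
  have V: "Linf_sub M F \<subseteq> Linf M" by (rule Linf_sub_Linf[OF F])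
  have add: "(\<lambda>x. f x + g x) \<in> members M (Linf_sub M F)"
    if fg: "f \<in> members M (Linf_sub M F)" "g \<in> members M (Linf_sub M F)" for f g
  proof -
    obtain f' g' where [measurable]: "f' \<in> borel_measurable F" "g' \<in> borel_measurable F"
      and eq: "AE x in M. f x = f' x" "AE x in M. g x = g' x"
      using fg by (auto simp: members_Linf_sub_iff[OF F])
    have "AE x in M. f x + g x = f' x + g' x" using eq by eventually_elim simp
    moreover have "(\<lambda>x. f' x + g' x) \<in> borel_measurable F" by measurable
    ultimately show ?thesis
      by (intro members_Linf_subI[OF F Linf_fun_add[OF fg[THEN membersD(1)]]])
  qed
  have scale: "(\<lambda>x. c * f x) \<in> members M (Linf_sub M F)" if f: "f \<in> members M (Linf_sub M F)" for f c
  proof -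
    obtain f' where [measurable]: "f' \<in> borel_measurable F" and eq: "AE x in M. f x = f' x"
      using f by (auto simp: members_Linf_sub_iff[OF F])
    have "AE x in M. c * f x = c * f' x" using eq by eventually_elim simp
    moreover have "(\<lambda>x. c * f' x) \<in> borel_measurable F" by measurable
    ultimately show ?thesis
      by (intro members_Linf_subI[OF F Linf_fun_scale[OF membersD(1)[OF f]]])
  qed
  have "(\<lambda>_. 0) \<in> members M (Linf_sub M F)"
    by (rule members_Linf_subI[OF F Linf_fun_const, of "\<lambda>_. 0"]) auto
  then have "Linf_zero M \<in> Linf_sub M F" by (simp add: Linf_zero_def membersD)
  moreover have "Linf_add M \<phi> \<psi> \<in> Linf_sub M F" if \<phi>\<psi>: "\<phi> \<in> Linf_sub M F" "\<psi> \<in> Linf_sub M F" for \<phi> \<psi>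
  proof -
    obtain f g where fg: "f \<in> members M (Linf_sub M F)" "g \<in> members M (Linf_sub M F)"
      "\<phi> = cls M f" "\<psi> = cls M g"
      using \<phi>\<psi> mem_iff_members[OF V] by meson
    then show ?thesis using membersD(2)[OF add[OF fg(1,2)]] by (simp add: Linf_add_cls membersD(1))
  qed
  moreover have "Linf_scale M c \<phi> \<in> Linf_sub M F" if \<phi>: "\<phi> \<in> Linf_sub M F" for \<phi> c
  proof -
    obtain f where f: "f \<in> members M (Linf_sub M F)" "\<phi> = cls M f"
      using \<phi> mem_iff_members[OF V] by meson
    then show ?thesis using membersD(2)[OF scale[OF f(1)]] by (simp add: Linf_scale_cls membersD(1))
  qed
  ultimately show ?thesis using V by (simp add: Linf_subspace_def)
qed

text \<open>F may lack null sets, so f itself may fail to be F-measurable. F-measurable versions of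
  approximants within \<open>1 / real (Suc n)\<close> are chosen instead; their \<open>lim\<close>
  is F-measurable on the whole space and equals f off a countable union of null sets.\<close>

lemma norm_closure_Linf_sub:
  assumes F: "subalgebra M F"
  shows "norm_closure M (Linf_sub M F) \<subseteq> Linf_sub M F"
proof
  fix \<phi> assume \<phi>: "\<phi> \<in> norm_closure M (Linf_sub M F)"
  then have "\<phi> \<in> Linf M" by (simp add: norm_closure_def)
  then obtain f where f: "f \<in> Linf_fun M" "\<phi> = cls M f" using cls_rep by metis
  have "\<exists>g\<in>borel_measurable F. AE x in M. norm (f x - g x) \<le> 1 / real (Suc n)" for n
  proof -
    obtain g where g: "g \<in> members M (Linf_sub M F)" "AE x in M. norm (f x - g x) \<le> 1 / real (Suc n)"
      using norm_closureD[OF Linf_sub_Linf[OF F] f(1), of "1 / real (Suc n)"] \<phi> f(2) by auto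
    obtain g' where g': "g' \<in> borel_measurable F" "AE x in M. g x = g' x"
      using g(1) by (auto simp: members_Linf_sub_iff[OF F])
    have "AE x in M. norm (f x - g' x) \<le> 1 / real (Suc n)" using g(2) g'(2) by eventually_elim simp
    with g'(1) show ?thesis by blast
  qed
  then obtain g where g[measurable]: "\<And>n. g n \<in> borel_measurable F"
    and le: "\<And>n. AE x in M. norm (f x - g n x) \<le> 1 / real (Suc n)" by metis
  have "AE x in M. \<forall>n. norm (f x - g n x) \<le> 1 / real (Suc n)" using le by (simp add: AE_all_countable)
  then have "AE x in M. f x = lim (\<lambda>n. g n x)"
  proof eventually_elim
    case (elim x)
    have "(\<lambda>n. f x - g n x) \<longlonglongrightarrow> 0"
      by (rule Lim_null_comparison[OF _ LIMSEQ_inverse_real_of_nat])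
         (use elim in \<open>simp add: inverse_eq_divide\<close>)
    then have "(\<lambda>n. f x - (f x - g n x)) \<longlonglongrightarrow> f x - 0" by (intro tendsto_diff tendsto_const)
    then show ?case by (simp add: limI)
  qed
  moreover have "(\<lambda>x. lim (\<lambda>n. g n x)) \<in> borel_measurable F" by measurable
  ultimately have "f \<in> members M (Linf_sub M F)" using f(1) by (auto simp: members_Linf_sub_iff[OF F])
  then show "\<phi> \<in> Linf_sub M F" using f(2) membersD(2) by blast
qed

context linf_subalgebra
begin

text \<open>Order-closedness makes \<open>proj_sets M N\<close> a \<sigma>-algebra and essentially
  order-closed. Density of the span gives \<open>N \<subseteq> Linf_sub M F\<close>, as the right
  side is a norm closed subspace containing the projections.\<close>

lemma Linf_sub_if_spanned_by_projections:
  assumes "densely_spanned_by_projections M N" "projections_order_closed M N"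
  shows "\<exists>F. subalgebra M F \<and> essentially_order_closed M F \<and> N = Linf_sub M F"
proof -
  define F where "F = sigma (space M) (proj_sets M N)"
  have "sigma_algebra (space M) (proj_sets M N)"
    unfolding sigma_algebra_iff2
  proof (intro conjI ballI allI impI)
    show "proj_sets M N \<subseteq> Pow (space M)" using proj_sets_sets sets.space_closed by blast
    fix A :: "nat \<Rightarrow> 'a set" assume "range A \<subseteq> proj_sets M N"
    then show "(\<Union>i. A i) \<in> proj_sets M N"
      using proj_sets_ess_union[OF assms(2) _ is_ess_union_UN] proj_sets_sets by blast
  qed (auto intro: proj_sets_empty proj_sets_Compl)
  then have F: "space F = space M" "sets F = proj_sets M N"
    unfolding F_def by (simp_all add: sigma_algebra.space_measure_of_eq sigma_algebra.sets_measure_of_eq)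
  have sub: "subalgebra M F" using proj_sets_sets by (simp add: subalgebra_def F)
  have "essentially_order_closed M F"
    unfolding essentially_order_closed_def
  proof (intro allI impI)
    fix S s
    assume S: "S \<subseteq> {cls M (indicator E) |E. E \<in> sets F}"
      and sup: "is_supremum M (projections M (Linf M)) S s"
    define \<E> where "\<E> = {E \<in> proj_sets M N. cls M (indicator E) \<in> S}"
    have \<E>: "S = (\<lambda>E. cls M (indicator E)) ` \<E>" "\<E> \<subseteq> proj_sets M N"
      using S by (auto simp: \<E>_def F)
    obtain H where H: "H \<in> sets M" "s = cls M (indicator H)"
      using sup by (auto simp: is_supremum_def projections_Linf)
    have "is_ess_union M \<E> H"
      using sup \<E> H is_supremum_projections_iff[of \<E> M H] proj_sets_sets by auto
    then have "H \<in> sets F" using proj_sets_ess_union[OF assms(2)] \<E> F by blast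
    then show "s \<in> {cls M (indicator E) |E. E \<in> sets F}" using H by blast
  qed
  moreover have "N = Linf_sub M F"
  proof
    have "projections M N \<subseteq> Linf_sub M F"
    proof
      fix p assume "p \<in> projections M N"
      then obtain E where E: "E \<in> proj_sets M N" "p = cls M (indicator E)"
        by (auto simp: projections_eq[OF sub_Linf])
      then have [measurable]: "E \<in> sets F" by (simp add: F)
      have "(indicator E :: 'a \<Rightarrow> complex) \<in> borel_measurable F" by measurable
      moreover have "bounded ((indicator E :: 'a \<Rightarrow> complex) ` space M)"
        by (auto simp: bounded_iff indicator_def intro!: exI[of _ 1])
      ultimately show "p \<in> Linf_sub M F" using E by (auto simp: Linf_sub_def)
    qed
    then have "Linf_subspace M hull projections M N \<subseteq> Linf_sub M F"
      by (rule hull_minimal) (rule Linf_subspace_Linf_sub[OF sub])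
    then show "N \<subseteq> Linf_sub M F"
      using assms(1) norm_closure_mono norm_closure_Linf_sub[OF sub]
      unfolding densely_spanned_by_projections_def by (metis subset_trans)
    show "Linf_sub M F \<subseteq> N"
    proof
      fix \<phi> assume "\<phi> \<in> Linf_sub M F"
      then obtain f where f: "f \<in> members M (Linf_sub M F)" "\<phi> = cls M f"
        using mem_iff_members[OF Linf_sub_Linf[OF sub]] by blast
      then obtain g where g[measurable]: "g \<in> borel_measurable F" and eq: "AE x in M. f x = g x"
        and fL: "f \<in> Linf_fun M" by (auto simp: members_Linf_sub_iff[OF sub])
      have gM: "g \<in> borel_measurable M" using g measurable_from_subalg[OF sub] by blast
      obtain C where C: "AE x in M. norm (f x) \<le> C" using fL by (auto simp: Linf_fun_def)
      have "AE x in M. norm (g x) \<le> C" using C eq by eventually_elim simp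
      then have gL: "g \<in> Linf_fun M" using gM by (auto simp: Linf_fun_def)
      \<comment> \<open>Superlevel sets of an F-measurable function belong to \<open>sets F\<close>,
        that is to \<open>proj_sets M N\<close>, so the step functions approximating u lie in
        N.\<close>
      have spec: "u \<in> real_members M N" if u: "u \<in> Linf_real M" and um: "u \<in> borel_measurable F" for u
      proof (rule real_members_spectral[OF u])
        fix t
        have "{x \<in> space F. t < u x} \<in> sets F" using um by measurable
        then have "{x \<in> space M. t < u x} \<in> proj_sets M N" by (simp add: F)
        then show "indicator {x \<in> space M. t < u x} \<in> real_members M N"
          using proj_sets_sets indicator_real_members_iff by blast
      qed
      have "g \<in> members M N"
        by (intro members_cartesian spec Re_Linf_real Im_Linf_real gL) measurable
      then show "\<phi> \<in> N" using f(2) cls_eq_iff[OF fL gL] eq membersD(2) by simp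
    qed
  qed
  ultimately show ?thesis using sub by blast
qed

end

section \<open>Monotone closed subalgebras\<close>

lemma is_supremum_sa_part_iff:
  assumes "U \<subseteq> Linf_real M" "w \<in> Linf_real M"
  shows "is_supremum M (sa_part M (Linf M)) (rcls M ` U) (rcls M w) \<longleftrightarrow>
    (\<forall>u\<in>U. AE x in M. u x \<le> w x) \<and>
    (\<forall>b\<in>Linf_real M. (\<forall>u\<in>U. AE x in M. u x \<le> b x) \<longrightarrow> (AE x in M. w x \<le> b x))"
proof -
  have "u \<in> Linf_real M" if "u \<in> U" for u using assms(1) that by blast
  then show ?thesis
    using assms(2)
    by (simp add: is_supremum_def sa_part_eq[OF order_refl] real_members_Linf rcls_le_iff)
qed

lemma Linf_norm_rcls_le:
  "u \<in> Linf_real M \<Longrightarrow> AE x in M. \<bar>u x\<bar> \<le> C \<Longrightarrow> 0 \<le> C \<Longrightarrow> Linf_norm M (rcls M u) \<le> C"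
  unfolding rcls_def by (rule Linf_norm_le) (auto simp: of_real_Linf_fun_iff)

lemma Linf_subspace_hull:
  assumes "Linf_subspace M V" "P \<subseteq> V"
  shows "Linf_subspace M (Linf_subspace M hull P)"
proof -
  have "Linf_subspace M hull P \<subseteq> V" by (rule hull_minimal[where S = "Linf_subspace M", OF assms(2,1)])
  moreover have "V \<subseteq> Linf M" using assms(1) by (simp add: Linf_subspace_def)
  ultimately have "Linf_subspace M hull P \<subseteq> Linf M" by simp
  then show ?thesis unfolding Linf_subspace_def hull_def by simp
qed

text \<open>V is not known to be norm closed, so \<open>members_cartesian\<close> does not reach its
  closure; approximations of the real and imaginary parts within \<open>e / 2\<close> are recombined
  instead.\<close>

lemma (in linf_subspace) norm_closure_cartesian:
  assumes "f \<in> Linf_fun M" "rcls M (\<lambda>x. Re (f x)) \<in> norm_closure M V"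
    "rcls M (\<lambda>x. Im (f x)) \<in> norm_closure M V"
  shows "cls M f \<in> norm_closure M V"
proof (rule norm_closureI[OF sub_Linf assms(1)])
  fix e :: real assume "e > 0"
  have L: "(\<lambda>x. complex_of_real (Re (f x))) \<in> Linf_fun M" "(\<lambda>x. complex_of_real (Im (f x))) \<in> Linf_fun M"
    using assms(1) by (simp_all add: of_real_Linf_fun_iff Re_Linf_real Im_Linf_real)
  obtain g where g: "g \<in> members M V" "AE x in M. norm (complex_of_real (Re (f x)) - g x) \<le> e / 2"
    using norm_closureD[OF sub_Linf L(1), of "e / 2"] assms(2) \<open>e > 0\<close> by (auto simp: rcls_def)
  obtain h where h: "h \<in> members M V" "AE x in M. norm (complex_of_real (Im (f x)) - h x) \<le> e / 2"
    using norm_closureD[OF sub_Linf L(2), of "e / 2"] assms(3) \<open>e > 0\<close> by (auto simp: rcls_def)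
  have "AE x in M. norm (f x - (g x + \<i> * h x)) \<le> e"
    using g(2) h(2)
  proof eventually_elim
    case (elim x)
    have "f x - (g x + \<i> * h x)
        = (complex_of_real (Re (f x)) - g x) + \<i> * (complex_of_real (Im (f x)) - h x)"
      by (subst complex_eq[of "f x"]) (simp add: algebra_simps)
    also have "norm \<dots> \<le> e / 2 + e / 2"
      using elim by (intro norm_triangle_mono) (auto simp: norm_mult)
    finally show ?case by simp
  qed
  moreover have "(\<lambda>x. g x + \<i> * h x) \<in> members M V" by (intro members_add members_scale g h)
  ultimately show "\<exists>g\<in>members M V. AE x in M. norm (f x - g x) \<le> e"
    by (rule rev_bexI[rotated])
qed

context linf_subalgebra
begin

lemma real_members_min:
  assumes "u \<in> real_members M N" "v \<in> real_members M N"
  shows "(\<lambda>x. min (u x) (v x)) \<in> real_members M N"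
proof -
  have "(\<lambda>x. (-1) * max ((-1) * u x) ((-1) * v x)) \<in> real_members M N"
    by (intro real_members_scale real_members_max assms)
  moreover have "(-1) * max ((-1) * u x) ((-1) * v x) = min (u x) (v x)" for x
    by (auto simp: max_def min_def)
  ultimately show ?thesis by simp
qed

text \<open>A limit from below is a supremum: an a.e. upper bound of all \<open>v n\<close> also
  bounds their limit w, the countably many null sets being merged.\<close>

lemma sa_monotone_closed_limit:
  assumes mc: "sa_monotone_closed M N" and v: "\<And>n. v n \<in> real_members M N"
    and bd: "\<And>n. AE x in M. \<bar>v n x\<bar> \<le> C" "0 \<le> C" and w: "w \<in> Linf_real M"
    and lim: "AE x in M. (\<forall>n. v n x \<le> w x) \<and> (\<lambda>n. v n x) \<longlonglongrightarrow> w x"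
  shows "w \<in> real_members M N"
proof -
  have vL: "v n \<in> Linf_real M" for n using v by (simp add: real_members_iff)
  have "is_supremum M (sa_part M (Linf M)) (rcls M ` range v) (rcls M w)"
  proof (subst is_supremum_sa_part_iff)
    show "range v \<subseteq> Linf_real M" using vL by blast
    have "AE x in M. v n x \<le> w x" for n using lim by eventually_elim simp
    moreover have "AE x in M. w x \<le> b x" if "\<And>n. AE x in M. v n x \<le> b x" for b
    proof -
      have "AE x in M. \<forall>n. v n x \<le> b x" using that by (simp add: AE_all_countable)
      with lim show ?thesis by eventually_elim (blast intro: LIMSEQ_le_const2)
    qed
    ultimately show "(\<forall>u\<in>range v. AE x in M. u x \<le> w x) \<and>
        (\<forall>b\<in>Linf_real M. (\<forall>u\<in>range v. AE x in M. u x \<le> b x) \<longrightarrow> (AE x in M. w x \<le> b x))"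
      by simp
  qed (rule w)
  moreover have "rcls M ` range v \<subseteq> sa_part M N" using v by (auto simp: sa_part_eq[OF sub_Linf])
  moreover have "\<exists>C. \<forall>a\<in>rcls M ` range v. Linf_norm M a \<le> C"
    using Linf_norm_rcls_le[OF vL bd] by blast
  ultimately have "rcls M w \<in> sa_part M N" using mc unfolding sa_monotone_closed_def by blast
  then show ?thesis using w by (simp add: sa_part_def real_members_iff)
qed

lemma sa_monotone_closed_superlevel:
  assumes mc: "sa_monotone_closed M N" and u: "u \<in> real_members M N"
  shows "indicator {x \<in> space M. t < u x} \<in> real_members M N"
proof (rule sa_monotone_closed_limit[OF mc])
  define v where "v n x = min 1 (real n * max 0 (u x + (-t)))" for n x
  show "v n \<in> real_members M N" for n
    unfolding v_def
    by (intro real_members_min real_members_scale real_members_const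
        real_members_continuous[where \<phi> = "max 0"] real_members_add u continuous_intros)
  show "AE x in M. \<bar>v n x\<bar> \<le> 1" for n by (intro AE_I2) (simp add: v_def)
  have [measurable]: "u \<in> borel_measurable M" using u by (simp add: real_members_iff Linf_realD)
  show "indicator {x \<in> space M. t < u x} \<in> Linf_real M"
    by (rule indicator_Linf_real) measurable
  show "AE x in M. (\<forall>n. v n x \<le> indicator {x \<in> space M. t < u x} x) \<and>
      (\<lambda>n. v n x) \<longlonglongrightarrow> indicator {x \<in> space M. t < u x} x"
  proof (intro AE_I2)
    fix x assume x: "x \<in> space M"
    show "(\<forall>n. v n x \<le> indicator {x \<in> space M. t < u x} x) \<and>
      (\<lambda>n. v n x) \<longlonglongrightarrow> indicator {x \<in> space M. t < u x} x"
    proof (cases "t < u x")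
      case True
      \<comment> \<open>From \<open>n0\<close> on, \<open>n * (u x - t)\<close> is at least 1 and
        the ramp is cut off at 1.\<close>
      obtain n0 :: nat where n0: "1 / (u x - t) < real n0" using reals_Archimedean2 by blast
      have "v n x = 1" if "n \<ge> n0" for n
      proof -
        have "1 / (u x - t) \<le> real n" using n0 that by linarith
        then show ?thesis using True by (simp add: v_def field_simps)
      qed
      then have "(\<lambda>n. v n x) \<longlonglongrightarrow> 1"
        by (intro tendsto_eventually) (auto simp: eventually_sequentially)
      then show ?thesis using True x by (simp add: v_def)
    next
      \<comment> \<open>The ramps vanish also where \<open>u x = t\<close>, in accordance with the
        strict inequality in the superlevel set.\<close>
      case False
      then show ?thesis by (simp add: v_def max_def)
    qed
  qed
qed simp

text \<open>Monotone closedness puts the superlevel sets of real members of N among the projections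
  of N. Hence the approximating step functions lie in the span, and it is the span to which
  \<open>spectral_approximation\<close> is applied.\<close>

lemma spanned_by_projections_if_monotone_closed:
  assumes mc: "sa_monotone_closed M N"
  shows "densely_spanned_by_projections M N"
  unfolding densely_spanned_by_projections_def
proof
  let ?V = "Linf_subspace M hull projections M N"
  have PN: "projections M N \<subseteq> N" by (auto simp: projections_def)
  interpret V: linf_subspace M ?V
    by unfold_locales (rule Linf_subspace_hull[OF subspace PN])
  have "?V \<subseteq> N" by (rule hull_minimal[where S = "Linf_subspace M", OF PN subspace])
  then show "norm_closure M ?V \<subseteq> N" using norm_closure_mono norm_closure_sub by blast
  have ind: "indicator E \<in> real_members M ?V" if "indicator E \<in> real_members M N" "E \<in> sets M" for E
  proof -
    have "cls M (indicator E) \<in> projections M N"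
      using that by (simp add: indicator_real_members_iff projections_eq[OF sub_Linf])
    then have "cls M (indicator E) \<in> ?V" by (rule hull_inc)
    then show ?thesis using that(2) by (simp add: indicator_real_members_iff proj_sets_def)
  qed
  have "(\<lambda>_. 1) \<in> real_members M ?V"
  proof (rule real_members_cong[OF ind])
    show "indicator (space M) \<in> real_members M N"
      by (rule real_members_cong[OF real_members_const[of 1]]) (auto intro!: indicator_Linf_real)
    show "(\<lambda>_. 1) \<in> Linf_real M" using real_members_const[of 1] by (simp add: real_members_iff)
  qed auto
  moreover have "indicator {x \<in> space M. t < u x} \<in> real_members M ?V"
    if u: "u \<in> real_members M N" for u t
  proof (rule ind[OF sa_monotone_closed_superlevel[OF mc u]])
    have [measurable]: "u \<in> borel_measurable M" using u by (simp add: real_members_iff Linf_realD)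
    show "{x \<in> space M. t < u x} \<in> sets M" by measurable
  qed
  ultimately have real: "rcls M u \<in> norm_closure M ?V" if "u \<in> real_members M N" for u
    using V.spectral_approximation[of u] that by (simp add: real_members_iff)
  show "N \<subseteq> norm_closure M ?V"
  proof
    fix \<phi> assume "\<phi> \<in> N"
    then obtain f where f: "f \<in> members M N" "\<phi> = cls M f" using mem_iff_members[OF sub_Linf] by blast
    then show "\<phi> \<in> norm_closure M ?V"
      using V.norm_closure_cartesian[OF membersD(1) real real] members_Re members_Im by simp
  qed
qed

lemma projections_order_closed_if_monotone_closed:
  assumes mc: "sa_monotone_closed M N"
  shows "projections_order_closed M N"
  unfolding projections_order_closed_def
proof (intro allI impI)
  fix I :: "'a class_fun set" and r p s
  assume net: "increasing_net M (projections M N) I r p"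
    and sup: "is_supremum M (projections M (Linf M)) (p ` I) s"
  define \<E> where "\<E> = {E \<in> proj_sets M N. cls M (indicator E) \<in> p ` I}"
  have eq: "S = h ` {x \<in> A. h x \<in> S}" if "S \<subseteq> h ` A"
    for S :: "'a class_fun set" and A :: "'a set set" and h using that by blast
  have "p ` I \<subseteq> projections M N" using net by (auto simp: increasing_net_def)
  then have \<E>: "p ` I = (\<lambda>E. cls M (indicator E)) ` \<E>"
    unfolding \<E>_def projections_eq[OF sub_Linf] by (rule eq)
  have \<E>': "p ` I = rcls M ` indicator ` \<E>" unfolding \<E> by (simp add: image_image rcls_indicator)
  have \<E>N: "\<E> \<subseteq> proj_sets M N" and \<E>M: "\<E> \<subseteq> sets M" using proj_sets_sets by (auto simp: \<E>_def)
  have "\<E> \<noteq> {}" using net \<E> by (auto simp: increasing_net_def)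
  obtain H where H: "H \<in> sets M" "s = cls M (indicator H)"
    using sup by (auto simp: is_supremum_def projections_Linf)
  have un: "is_ess_union M \<E> H"
    using sup \<E> H is_supremum_projections_iff[OF \<E>M H(1)] by simp
  have "is_supremum M (sa_part M (Linf M)) (rcls M ` indicator ` \<E>) (rcls M (indicator H))"
  proof (subst is_supremum_sa_part_iff)
    show "indicator ` \<E> \<subseteq> Linf_real M" using \<E>M indicator_Linf_real by blast
    show "indicator H \<in> Linf_real M" using H indicator_Linf_real by blast
    have "AE x in M. indicator E x \<le> (indicator H x :: real)" if "E \<in> \<E>" for E
    proof -
      have "ae_subset M E H" using un that by (simp add: is_ess_union_def)
      then show ?thesis by eventually_elim (simp add: indicator_def)
    qed
    moreover have "AE x in M. indicator H x \<le> b x"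
      if b: "b \<in> Linf_real M" and ub: "\<And>E. E \<in> \<E> \<Longrightarrow> AE x in M. indicator E x \<le> b x" for b :: "'a \<Rightarrow> real"
    proof -
      have [measurable]: "b \<in> borel_measurable M" using b by (rule Linf_realD)
      \<comment> \<open>The bound b is an arbitrary real function, but it is at least 1 a.e. on
        every E. So U is an upper bound of \<E> among sets, and H lies below it.\<close>
      define U where "U = {x \<in> space M. 1 \<le> b x}"
      have U: "U \<in> sets M" unfolding U_def by measurable
      have "ae_subset M E U" if "E \<in> \<E>" for E
        using ub[OF that] AE_space by eventually_elim (auto simp: U_def indicator_def)
      then have HU: "ae_subset M H U" using un U by (simp add: is_ess_union_def)
      \<comment> \<open>Off H the inequality is \<open>0 \<le> b x\<close>, which any single E
        supplies; nonemptiness of the net enters here.\<close>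
      obtain E where "E \<in> \<E>" using \<open>\<E> \<noteq> {}\<close> by blast
      from ub[OF this] have "AE x in M. 0 \<le> b x"
        by eventually_elim (meson indicator_pos_le order_trans)
      with HU show ?thesis by eventually_elim (auto simp: U_def indicator_def)
    qed
    ultimately show "(\<forall>u\<in>indicator ` \<E>. AE x in M. u x \<le> (indicator H x :: real)) \<and>
      (\<forall>b\<in>Linf_real M. (\<forall>u\<in>indicator ` \<E>. AE x in M. u x \<le> b x) \<longrightarrow> (AE x in M. indicator H x \<le> b x))"
      by simp
  qed
  moreover have "rcls M ` indicator ` \<E> \<subseteq> sa_part M N"
  proof -
    have "indicator E \<in> real_members M N" if "E \<in> \<E>" for E
      using that \<E>N \<E>M by (subst indicator_real_members_iff) auto
    then show ?thesis unfolding sa_part_eq[OF sub_Linf] by auto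
  qed
  moreover have "\<exists>C. \<forall>a\<in>rcls M ` indicator ` \<E>. Linf_norm M a \<le> C"
  proof (intro exI[of _ 1] ballI)
    fix a assume "a \<in> rcls M ` indicator ` \<E>"
    then obtain E where E: "E \<in> \<E>" "a = rcls M (indicator E)" by blast
    then have "E \<in> sets M" using \<E>M by auto
    then show "Linf_norm M a \<le> 1"
      unfolding E(2) by (intro Linf_norm_rcls_le indicator_Linf_real) simp_all
  qed
  ultimately have "rcls M (indicator H) \<in> sa_part M N" using mc unfolding sa_monotone_closed_def by metis
  then have "H \<in> proj_sets M N" using H(1) by (simp add: sa_part_def proj_sets_def rcls_indicator)
  then show "s \<in> projections M N" using H(2) by (simp add: projections_eq[OF sub_Linf])
qed

end

section \<open>The weak* topology\<close>

lemma integrable_Linf_mult: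
  assumes "f \<in> Linf_fun M" "integrable M g"
  shows "integrable M (\<lambda>x. f x * g x :: complex)"
proof -
  obtain C where C: "AE x in M. norm (f x) \<le> C" using assms(1) by (auto simp: Linf_fun_def)
  have [measurable]: "f \<in> borel_measurable M" "g \<in> borel_measurable M"
    using assms by (auto simp: Linf_fun_def)
  show ?thesis
  proof (rule Bochner_Integration.integrable_bound)
    show "integrable M (\<lambda>x. C * norm (g x))" using assms(2) by simp
    show "AE x in M. norm (f x * g x) \<le> norm (C * norm (g x))"
      using C
    proof eventually_elim
      case (elim x)
      then have "norm (f x) * norm (g x) \<le> \<bar>C\<bar> * norm (g x)" by (intro mult_right_mono) auto
      then show ?case by (simp add: norm_mult abs_mult)
    qed
  qed measurable
qed

lemma integrable_Linf_real_mult: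
  fixes g :: "'a \<Rightarrow> real"
  assumes "u \<in> Linf_real M" "integrable M g"
  shows "integrable M (\<lambda>x. u x * g x)"
proof -
  have "integrable M (\<lambda>x. complex_of_real (u x) * complex_of_real (g x))"
    using assms by (intro integrable_Linf_mult) (auto simp: of_real_Linf_fun_iff)
  then have "integrable M (\<lambda>x. Re (complex_of_real (u x) * complex_of_real (g x)))"
    by (rule integrable_Re)
  then show ?thesis by simp
qed

lemma L1_pairing_cls:
  assumes "f \<in> Linf_fun M" "integrable M g"
  shows "L1_pairing M (cls M f) g = (\<integral>x. f x * g x \<partial>M)"
  unfolding L1_pairing_def
proof (rule integral_cong_AE)
  show "AE x in M. rep (cls M f) x * g x = f x * g x"
    using rep_cls(2)[OF assms(1)] by eventually_elim simp
  show "(\<lambda>x. rep (cls M f) x * g x) \<in> borel_measurable M" "(\<lambda>x. f x * g x) \<in> borel_measurable M"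
    using assms rep_cls(1)[OF assms(1)] by (auto simp: Linf_fun_def)
qed

lemma L1_pairing_rcls:
  assumes "u \<in> Linf_real M" "integrable M g"
  shows "L1_pairing M (rcls M u) g = (\<integral>x. complex_of_real (u x) * g x \<partial>M)"
  unfolding rcls_def using assms by (intro L1_pairing_cls) (simp_all add: of_real_Linf_fun_iff)

text \<open>Sequences adapted to finite sets G suffice although the topology may not be first
  countable: for every open set around s there is a finite G such that each sequence in
  \<open>Linf M\<close> converging to s against G is eventually in that set.\<close>

lemma weak_star_closed_approximable:
  assumes cl: "closedin (weak_star_topology M) V" and s: "s \<in> Linf M"
    and seq: "\<And>G. finite G \<Longrightarrow> \<forall>g\<in>G. integrable M g \<Longrightarrow>
      \<exists>\<phi>. (\<forall>n. \<phi> n \<in> V) \<and> (\<forall>g\<in>G. (\<lambda>n. L1_pairing M (\<phi> n) g) \<longlonglongrightarrow> L1_pairing M s g)"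
  shows "s \<in> V"
proof (rule ccontr)
  assume "s \<notin> V"
  have VL: "V \<subseteq> Linf M" using closedin_subset[OF cl] by (simp add: topspace_weak_star_topology)
  let ?B = "{{\<phi> \<in> Linf M. L1_pairing M \<phi> g \<in> U} |g U. integrable M g \<and> open U}"
  \<comment> \<open>This property passes to finite intersections, by uniting the sets G, and to
    unions, so it can be proved by induction over the generation of open sets.\<close>
  define near where "near G U \<longleftrightarrow> (\<forall>\<phi>. (\<forall>n. \<phi> n \<in> Linf M) \<and>
      (\<forall>g\<in>G. (\<lambda>n. L1_pairing M (\<phi> n) g) \<longlonglongrightarrow> L1_pairing M s g) \<longrightarrow>
      (\<forall>\<^sub>F n in sequentially. \<phi> n \<in> U))" for G U
  have nbhd: "\<exists>G. finite G \<and> (\<forall>g\<in>G. integrable M g) \<and> near G U"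
    if "generate_topology_on ?B U" "s \<in> U" for U
    using that
  proof induction
    case Empty
    then show ?case by simp
  next
    case (Int A B)
    then obtain G H where "finite G" "\<forall>g\<in>G. integrable M g" "near G A"
      "finite H" "\<forall>g\<in>H. integrable M g" "near H B" by auto
    moreover from this have "near (G \<union> H) (A \<inter> B)"
      unfolding near_def by (simp add: eventually_conj_iff)
    ultimately show ?case by (intro exI[of _ "G \<union> H"]) auto
  next
    case (UN K)
    then obtain A where A: "A \<in> K" "s \<in> A" by blast
    then obtain G where G: "finite G" "\<forall>g\<in>G. integrable M g" "near G A" using UN.IH by meson
    have "near G (\<Union>K)"
      unfolding near_def
    proof (intro allI impI)
      fix \<phi> assume "(\<forall>n. \<phi> n \<in> Linf M) \<and>
        (\<forall>g\<in>G. (\<lambda>n. L1_pairing M (\<phi> n) g) \<longlonglongrightarrow> L1_pairing M s g)"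
      then have "\<forall>\<^sub>F n in sequentially. \<phi> n \<in> A" using G(3) unfolding near_def by simp
      then show "\<forall>\<^sub>F n in sequentially. \<phi> n \<in> \<Union>K" by eventually_elim (rule UnionI[OF A(1)])
    qed
    with G(1,2) show ?case by (intro exI[of _ G]) simp
  next
    case (Basis A)
    then obtain g U where g: "A = {\<phi> \<in> Linf M. L1_pairing M \<phi> g \<in> U}" "integrable M g" "open U"
      by auto
    have "near {g} A"
      unfolding near_def
    proof (intro allI impI, elim conjE)
      fix \<phi> assume \<phi>: "\<forall>n. \<phi> n \<in> Linf M"
        "\<forall>g\<in>{g}. (\<lambda>n. L1_pairing M (\<phi> n) g) \<longlonglongrightarrow> L1_pairing M s g"
      have "\<forall>\<^sub>F n in sequentially. L1_pairing M (\<phi> n) g \<in> U"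
        using \<phi>(2) g(1,3) Basis(2) by (intro topological_tendstoD[of _ "L1_pairing M s g"]) auto
      then show "\<forall>\<^sub>F n in sequentially. \<phi> n \<in> A" using \<phi>(1) g(1) by simp
    qed
    with g(2) show ?case by (intro exI[of _ "{g}"]) simp
  qed
  have "openin (weak_star_topology M) (Linf M - V)"
    using cl by (simp add: closedin_def topspace_weak_star_topology)
  then have "generate_topology_on ?B (Linf M - V)"
    unfolding weak_star_topology_def by (rule openin_topology_generated_by)
  then obtain G where G: "finite G" "\<forall>g\<in>G. integrable M g" "near G (Linf M - V)"
    using nbhd[of "Linf M - V"] s \<open>s \<notin> V\<close> by auto
  obtain \<phi> where \<phi>: "\<forall>n. \<phi> n \<in> V" "\<forall>g\<in>G. (\<lambda>n. L1_pairing M (\<phi> n) g) \<longlonglongrightarrow> L1_pairing M s g"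
    using seq[OF G(1,2)] by blast
  moreover have "\<forall>n. \<phi> n \<in> Linf M" using \<phi>(1) VL by auto
  ultimately have "\<forall>\<^sub>F n in sequentially. \<phi> n \<in> Linf M - V"
    using G(3) unfolding near_def by blast
  then show False using \<phi>(1) by simp
qed

text \<open>The complement is a union of subbasic open sets, one for each g whose pairing fails to
  vanish.\<close>

lemma closedin_weak_star_annihilator:
  assumes "\<And>g. g \<in> H \<Longrightarrow> integrable M g"
  shows "closedin (weak_star_topology M) {\<phi> \<in> Linf M. \<forall>g\<in>H. L1_pairing M \<phi> g = 0}"
proof -
  have "openin (weak_star_topology M) {\<phi> \<in> Linf M. L1_pairing M \<phi> g \<in> - {0}}" if "g \<in> H" for g
    unfolding weak_star_topology_def
    by (rule topology_generated_by_Basis) (use assms[OF that] in blast)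
  then have "openin (weak_star_topology M) (\<Union>g\<in>H. {\<phi> \<in> Linf M. L1_pairing M \<phi> g \<in> - {0}})"
    by (intro openin_Union) auto
  moreover have "(\<Union>g\<in>H. {\<phi> \<in> Linf M. L1_pairing M \<phi> g \<in> - {0}}) =
      Linf M - {\<phi> \<in> Linf M. \<forall>g\<in>H. L1_pairing M \<phi> g = 0}" by auto
  ultimately show ?thesis by (simp add: closedin_def topspace_weak_star_topology)
qed

section \<open>Weak* closed subalgebras are monotone closed\<close>

lemma Linf_real_abs_add:
  assumes "u \<in> Linf_real M" "v \<in> Linf_real M"
  shows "(\<lambda>x. \<bar>u x\<bar> + \<bar>v x\<bar>) \<in> Linf_real M"
proof -
  obtain C D where "AE x in M. \<bar>u x\<bar> \<le> C" "AE x in M. \<bar>v x\<bar> \<le> D"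
    using assms unfolding Linf_real_def by auto
  then have "AE x in M. \<bar>\<bar>u x\<bar> + \<bar>v x\<bar>\<bar> \<le> C + D" by eventually_elim simp
  moreover have [measurable]: "u \<in> borel_measurable M" "v \<in> borel_measurable M"
    using assms by (auto dest: Linf_realD)
  have "(\<lambda>x. \<bar>u x\<bar> + \<bar>v x\<bar>) \<in> borel_measurable M" by measurable
  ultimately show ?thesis by (auto simp: Linf_real_def)
qed

lemma between_Linf_real:
  assumes "u \<in> borel_measurable M" "AE x in M. a x \<le> u x \<and> u x \<le> s x"
    "a \<in> Linf_real M" "s \<in> Linf_real M"
  shows "u \<in> Linf_real M"
proof (rule Linf_real_bounded_by[OF assms(1) _ Linf_real_abs_add[OF assms(3,4)]])
  show "AE x in M. \<bar>u x\<bar> \<le> \<bar>\<bar>a x\<bar> + \<bar>s x\<bar>\<bar>" using assms(2) by eventually_elim auto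
qed

text \<open>The integrals against \<open>g\<close> of the members of a directed family approach their supremum along
  an increasing sequence; its limit dominates the family wherever \<open>g\<close> is positive, since otherwise
  replacing it by a maximum would increase the integral.\<close>

lemma directed_sup_sequence:
  fixes W :: "('a \<Rightarrow> real) set" and g :: "'a \<Rightarrow> real"
  assumes a: "a \<in> Linf_real M" and s: "s \<in> Linf_real M" and "W \<noteq> {}"
    and meas: "\<And>u. u \<in> W \<Longrightarrow> u \<in> borel_measurable M"
    and bet: "\<And>u. u \<in> W \<Longrightarrow> AE x in M. a x \<le> u x \<and> u x \<le> s x"
    and max: "\<And>u v. u \<in> W \<Longrightarrow> v \<in> W \<Longrightarrow> (\<lambda>x. max (u x) (v x)) \<in> W"
    and g: "integrable M g" "\<And>x. 0 \<le> g x"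
  obtains v h where "\<And>n. v n \<in> W" "h \<in> borel_measurable M"
    "AE x in M. (\<lambda>n. v n x) \<longlonglongrightarrow> h x" "AE x in M. a x \<le> h x \<and> h x \<le> s x"
    "\<And>u. u \<in> W \<Longrightarrow> AE x in M. 0 < g x \<longrightarrow> u x \<le> h x"
proof -
  define J where "J u = (\<integral>x. u x * g x \<partial>M)" for u
  have intg: "integrable M (\<lambda>x. u x * g x)"
    if "u \<in> borel_measurable M" "AE x in M. a x \<le> u x \<and> u x \<le> s x" for u
    by (rule integrable_Linf_real_mult[OF between_Linf_real[OF that a s] g(1)])
  have Jle: "J u \<le> J w" if "integrable M (\<lambda>x. u x * g x)" "integrable M (\<lambda>x. w x * g x)"
    "AE x in M. u x \<le> w x" for u w
    unfolding J_def
  proof (rule integral_mono_AE[OF that(1,2)])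
    show "AE x in M. u x * g x \<le> w x * g x"
      using that(3) by eventually_elim (intro mult_right_mono g)
  qed
  have bdd: "bdd_above (J ` W)"
  proof (rule bdd_aboveI2)
    fix u assume "u \<in> W"
    then show "J u \<le> J s"
      using bet by (intro Jle intg meas integrable_Linf_real_mult[OF s g(1)]) (auto elim: eventually_mono)
  qed
  define c where "c = (SUP u\<in>W. J u)"
  have "\<exists>u\<in>W. c - 1 / real (Suc n) < J u" for n
  proof -
    have "c - 1 / real (Suc n) < (SUP u\<in>W. J u)" unfolding c_def by simp
    then show ?thesis using less_cSUP_iff[OF \<open>W \<noteq> {}\<close> bdd] by blast
  qed
  then obtain u where u: "\<And>n. u n \<in> W" "\<And>n. c - 1 / real (Suc n) < J (u n)" by metis
  \<comment> \<open>Running maxima of the near-optimal \<open>u n\<close>: they remain in W,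
    increase pointwise, and have integrals at least as large.\<close>
  define v where "v = rec_nat (u 0) (\<lambda>n w x. max (w x) (u (Suc n) x))"
  have v0: "v 0 = u 0" and vS: "v (Suc n) = (\<lambda>x. max (v n x) (u (Suc n) x))" for n
    by (simp_all add: v_def)
  have vW: "v n \<in> W" for n by (induction n) (simp_all add: v0 vS u max)
  have uv: "u n x \<le> v n x" for n x by (cases n) (simp_all add: v0 vS)
  have inc: "incseq (\<lambda>n. v n x)" for x by (rule incseq_SucI) (simp add: vS)
  define h where "h x = lim (\<lambda>n. v n x)" for x
  have [measurable]: "v n \<in> borel_measurable M" for n using vW meas by blast
  have h: "h \<in> borel_measurable M" unfolding h_def by measurable
  have vb: "AE x in M. \<forall>n. a x \<le> v n x \<and> v n x \<le> s x"
    using bet[OF vW] by (simp add: AE_all_countable)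
  then have lim: "AE x in M. (\<lambda>n. v n x) \<longlonglongrightarrow> h x"
  proof eventually_elim
    case (elim x)
    then obtain L where "(\<lambda>n. v n x) \<longlonglongrightarrow> L" using incseq_convergent[OF inc, of x "s x"] by blast
    then show ?case by (simp add: h_def limI)
  qed
  have hb: "AE x in M. a x \<le> h x \<and> h x \<le> s x"
    using vb lim by eventually_elim (meson LIMSEQ_le_const LIMSEQ_le_const2)
  define b where "b x = (\<bar>a x\<bar> + \<bar>s x\<bar>) * g x" for x
  have b: "integrable M b"
    unfolding b_def by (rule integrable_Linf_real_mult[OF Linf_real_abs_add[OF a s] g(1)])
  have conv: "(\<lambda>n. J (w n)) \<longlonglongrightarrow> J k"
    if "\<And>n. w n \<in> W" "k \<in> borel_measurable M" "AE x in M. (\<lambda>n. w n x) \<longlonglongrightarrow> k x" for w k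
    unfolding J_def
  proof (rule integral_dominated_convergence[OF _ _ b])
    have [measurable]: "w n \<in> borel_measurable M" for n using that(1) meas by blast
    have [measurable]: "g \<in> borel_measurable M" using g by auto
    show "(\<lambda>x. w n x * g x) \<in> borel_measurable M" for n by measurable
    show "(\<lambda>x. k x * g x) \<in> borel_measurable M" using that(2) by measurable
    show "AE x in M. (\<lambda>n. w n x * g x) \<longlonglongrightarrow> k x * g x"
      using that(3) by eventually_elim (intro tendsto_mult tendsto_const)
    fix n
    show "AE x in M. norm (w n x * g x) \<le> b x"
      using bet[OF that(1)[of n]]
    proof eventually_elim
      case (elim x)
      then show ?case using g(2)[of x] by (auto simp: b_def abs_mult intro!: mult_right_mono)
    qed
  qed
  have Jc: "J w \<le> c" if "w \<in> W" for w unfolding c_def by (rule cSUP_upper[OF that bdd])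
  have "(\<lambda>n. J (v n)) \<longlonglongrightarrow> c"
  proof (rule tendsto_sandwich[of "\<lambda>n. c - 1 / real (Suc n)" _ _ "\<lambda>_. c"])
    have "c - 1 / real (Suc n) \<le> J (v n)" for n
    proof -
      have "J (u n) \<le> J (v n)" using uv by (intro Jle intg meas bet u vW) auto
      with u(2)[of n] show ?thesis by simp
    qed
    then show "\<forall>\<^sub>F n in sequentially. c - 1 / real (Suc n) \<le> J (v n)" by simp
    show "\<forall>\<^sub>F n in sequentially. J (v n) \<le> c" using Jc vW by simp
    have "(\<lambda>n. c - inverse (real (Suc n))) \<longlonglongrightarrow> c - 0"
      by (intro tendsto_diff tendsto_const LIMSEQ_inverse_real_of_nat)
    then show "(\<lambda>n. c - 1 / real (Suc n)) \<longlonglongrightarrow> c" by (simp add: inverse_eq_divide)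
  qed simp
  with conv[OF vW h lim] have Jh: "J h = c" using LIMSEQ_unique by blast
  have dom: "AE x in M. 0 < g x \<longrightarrow> w x \<le> h x" if w: "w \<in> W" for w
  proof -
    have [measurable]: "w \<in> borel_measurable M" "h \<in> borel_measurable M" using meas[OF w] h by auto
    define k where "k x = max (h x) (w x)" for x
    have k: "k \<in> borel_measurable M" unfolding k_def by measurable
    \<comment> \<open>k may lie outside W, but it is an a.e. limit of maxima that belong to W, and
      this gives \<open>J k \<le> c\<close>.\<close>
    have "AE x in M. (\<lambda>n. max (v n x) (w x)) \<longlonglongrightarrow> k x"
      using lim unfolding k_def by eventually_elim (intro tendsto_max tendsto_const)
    with k have "(\<lambda>n. J (\<lambda>x. max (v n x) (w x))) \<longlonglongrightarrow> J k"
      by (intro conv max vW w)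
    then have "J k \<le> c" by (rule LIMSEQ_le_const2) (use Jc max vW w in blast)
    have kb: "AE x in M. a x \<le> k x \<and> k x \<le> s x"
      using hb bet[OF w] by eventually_elim (simp add: k_def max_def)
    note ik = intg[OF k kb] and ih = intg[OF h hb]
    have i: "integrable M (\<lambda>x. k x * g x - h x * g x)" using ik ih by simp
    have nn: "0 \<le> k x * g x - h x * g x" for x
      using mult_right_mono[of "h x" "k x" "g x"] g(2)[of x] by (simp add: k_def)
    have "(\<integral>x. k x * g x - h x * g x \<partial>M) = J k - J h"
      unfolding J_def by (rule Bochner_Integration.integral_diff[OF ik ih])
    moreover have "0 \<le> (\<integral>x. k x * g x - h x * g x \<partial>M)" by (intro Bochner_Integration.integral_nonneg nn)
    ultimately have "(\<integral>x. k x * g x - h x * g x \<partial>M) = 0" using \<open>J k \<le> c\<close> Jh by simp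
    then have "AE x in M. k x * g x - h x * g x = 0"
      using integral_nonneg_eq_0_iff_AE[OF i] nn by simp
    then show ?thesis by eventually_elim (auto simp: k_def max_def split: if_splits)
  qed
  show ?thesis by (rule that[OF vW h lim hb dom])
qed

lemma (in linf_subalgebra) monotone_closed_if_weak_star_closed:
  assumes cl: "closedin (weak_star_topology M) N"
  shows "sa_monotone_closed M N"
  unfolding sa_monotone_closed_def
proof (intro allI impI)
  fix A \<sigma>
  assume A: "A \<subseteq> sa_part M N" and sup: "is_supremum M (sa_part M (Linf M)) A \<sigma>"
  define U where "U = {u \<in> real_members M N. rcls M u \<in> A}"
  have AU: "A = rcls M ` U" using A unfolding U_def sa_part_eq[OF sub_Linf] by auto
  have UL: "U \<subseteq> Linf_real M" by (auto simp: U_def real_members_iff)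
  obtain s where s: "s \<in> Linf_real M" "\<sigma> = rcls M s"
    using sup by (auto simp: is_supremum_def sa_part_eq[OF order_refl] real_members_Linf)
  have ub: "\<And>u. u \<in> U \<Longrightarrow> AE x in M. u x \<le> s x"
    and least: "\<And>b. b \<in> Linf_real M \<Longrightarrow> (\<And>u. u \<in> U \<Longrightarrow> AE x in M. u x \<le> b x) \<Longrightarrow> AE x in M. s x \<le> b x"
    using sup unfolding AU s(2) is_supremum_sa_part_iff[OF UL s(1)] by blast+
  have sL: "(\<lambda>x. complex_of_real (s x)) \<in> Linf_fun M" using s by (simp add: of_real_Linf_fun_iff)
  have "\<sigma> \<in> N"
  proof (cases "U = {}")
    case True
    \<comment> \<open>Every function bounds the empty family, so \<open>s x \<le> s x - 1\<close>
      a.e.; this happens only over a null space, where s agrees a.e. with 0.\<close>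
    have "(\<lambda>x. s x - 1) \<in> Linf_real M"
      by (rule Linf_real_continuous[OF s(1)]) (intro continuous_intros)
    then have "AE x in M. s x \<le> s x - 1" using least True by blast
    then have "AE x in M. 0 = s x" by eventually_elim simp
    then have "s \<in> real_members M N" by (rule real_members_cong[OF real_members_const s(1)])
    then show ?thesis using s(2) by (simp add: real_members_iff)
  next
    case False
    then obtain a where a: "a \<in> U" by blast
    then have aL: "a \<in> Linf_real M" and aN: "a \<in> real_members M N" using UL by (auto simp: U_def)
    \<comment> \<open>U need not be directed. The order interval of N between one member a and s is
      closed under maxima and has integrable bounds against any integrable weight. It contains
      \<open>max a u\<close> for every u in U, so its upper bounds are upper bounds of U.\<close>
    define W where "W = {u \<in> real_members M N. AE x in M. a x \<le> u x \<and> u x \<le> s x}"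
    have maxW: "(\<lambda>x. max (u x) (v x)) \<in> W" if "u \<in> W" "v \<in> W" for u v
    proof -
      have "AE x in M. a x \<le> max (u x) (v x) \<and> max (u x) (v x) \<le> s x"
        using that unfolding W_def by (auto elim: eventually_elim2)
      then show ?thesis using that real_members_max by (simp add: W_def)
    qed
    have UW: "(\<lambda>x. max (a x) (u x)) \<in> W" if "u \<in> U" for u
    proof -
      have "AE x in M. a x \<le> max (a x) (u x) \<and> max (a x) (u x) \<le> s x"
        using ub[OF a] ub[OF that] by eventually_elim simp
      then show ?thesis using that aN real_members_max by (simp add: W_def U_def)
    qed
    show ?thesis
    proof (rule weak_star_closed_approximable[OF cl])
      show "\<sigma> \<in> Linf M" using s(2) sL by (simp add: rcls_def cls_in_Linf)
      fix G :: "('a \<Rightarrow> complex) set" assume G: "finite G" "\<forall>g\<in>G. integrable M g"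
      \<comment> \<open>One weight for all of G: every k in G vanishes where g does.\<close>
      define g where "g x = (\<Sum>k\<in>G. norm (k x))" for x
      have g: "integrable M g" "\<And>x. 0 \<le> g x"
        unfolding g_def using G by (auto intro!: sum_nonneg)
      obtain v h where v: "\<And>n. v n \<in> W" and h: "h \<in> borel_measurable M"
        and lim: "AE x in M. (\<lambda>n. v n x) \<longlonglongrightarrow> h x" and hb: "AE x in M. a x \<le> h x \<and> h x \<le> s x"
        and dom: "\<And>u. u \<in> W \<Longrightarrow> AE x in M. 0 < g x \<longrightarrow> u x \<le> h x"
      proof (rule directed_sup_sequence[OF aL s(1), of W g])
        show "W \<noteq> {}" using UW[OF a] by blast
        show "u \<in> borel_measurable M" if "u \<in> W" for u
          using that by (simp add: W_def real_members_iff Linf_realD)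
        show "AE x in M. a x \<le> u x \<and> u x \<le> s x" if "u \<in> W" for u
          using that by (simp add: W_def)
      qed (use maxW g in auto)
      \<comment> \<open>The sequence is uncontrolled where g vanishes, so there h is replaced by s.
        The result bounds U, hence s lies below b, and h agrees a.e. with s wherever g is
        positive.\<close>
      define b where "b x = (if 0 < g x then h x else s x)" for x
      have [measurable]: "g \<in> borel_measurable M" "h \<in> borel_measurable M" "s \<in> borel_measurable M"
        using g h s by (auto dest: Linf_realD)
      have "b \<in> borel_measurable M" unfolding b_def by measurable
      moreover have "AE x in M. a x \<le> b x \<and> b x \<le> s x"
        using hb ub[OF a] by eventually_elim (simp add: b_def)
      ultimately have bL: "b \<in> Linf_real M" by (rule between_Linf_real[OF _ _ aL s(1)])
      have "AE x in M. u x \<le> b x" if "u \<in> U" for u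
        using dom[OF UW[OF that]] ub[OF that] by eventually_elim (auto simp: b_def)
      then have "AE x in M. s x \<le> b x" by (rule least[OF bL])
      then have limg: "AE x in M. 0 < g x \<longrightarrow> (\<lambda>n. v n x) \<longlonglongrightarrow> s x"
        using lim hb by eventually_elim (auto simp: b_def)
      have vL: "v n \<in> Linf_real M" for n using v by (simp add: W_def real_members_iff)
      have "(\<lambda>n. L1_pairing M (rcls M (v n)) k) \<longlonglongrightarrow> L1_pairing M \<sigma> k" if k: "k \<in> G" for k
      proof -
        have ik: "integrable M k" using k G by blast
        have [measurable]: "k \<in> borel_measurable M" "\<And>n. v n \<in> borel_measurable M"
          using ik vL by (auto dest: Linf_realD)
        have "(\<lambda>n. \<integral>x. complex_of_real (v n x) * k x \<partial>M)
            \<longlonglongrightarrow> (\<integral>x. complex_of_real (s x) * k x \<partial>M)"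
        proof (rule integral_dominated_convergence)
          show "integrable M (\<lambda>x. (\<bar>a x\<bar> + \<bar>s x\<bar>) * norm (k x))"
            using ik by (intro integrable_Linf_real_mult Linf_real_abs_add aL s) simp
          show "AE x in M. (\<lambda>n. complex_of_real (v n x) * k x) \<longlonglongrightarrow> complex_of_real (s x) * k x"
            using limg
          proof eventually_elim
            case (elim x)
            show ?case
            proof (cases "k x = 0")
              case False
              have "norm (k x) \<le> g x" unfolding g_def using k G by (intro member_le_sum) auto
              moreover have "0 < norm (k x)" using False by simp
              ultimately have "0 < g x" by linarith
              with elim show ?thesis by (intro tendsto_intros) auto
            qed simp
          qed
          fix n
          have "AE x in M. a x \<le> v n x \<and> v n x \<le> s x" using v by (simp add: W_def)
          then show "AE x in M. norm (complex_of_real (v n x) * k x) \<le> (\<bar>a x\<bar> + \<bar>s x\<bar>) * norm (k x)"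
            by eventually_elim (auto simp: norm_mult intro!: mult_right_mono)
        qed measurable
        then show ?thesis by (simp add: s(2) L1_pairing_rcls[OF _ ik] vL s(1))
      qed
      moreover have "rcls M (v n) \<in> N" for n using v by (simp add: W_def real_members_iff)
      ultimately show "\<exists>\<phi>. (\<forall>n. \<phi> n \<in> N) \<and> (\<forall>g\<in>G. (\<lambda>n. L1_pairing M (\<phi> n) g) \<longlonglongrightarrow> L1_pairing M \<sigma> g)"
        by (intro exI[of _ "\<lambda>n. rcls M (v n)"]) blast
    qed
  qed
  then show "\<sigma> \<in> sa_part M N" using s by (simp add: sa_part_def rcls_star)
qed

section \<open>Order closed sub-sigma-algebras give weak* closed subalgebras\<close>

lemma real_members_Linf_sub_iff:
  assumes F: "subalgebra M F"
  shows "u \<in> real_members M (Linf_sub M F) \<longleftrightarrow>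
    u \<in> Linf_real M \<and> (\<exists>w\<in>borel_measurable F. AE x in M. u x = w x)"
proof
  assume u: "u \<in> real_members M (Linf_sub M F)"
  then obtain g :: "'a \<Rightarrow> complex" where [measurable]: "g \<in> borel_measurable F"
    and eq: "AE x in M. complex_of_real (u x) = g x"
    by (auto simp: real_members_def members_Linf_sub_iff[OF F])
  have "(\<lambda>x. Re (g x)) \<in> borel_measurable F" by measurable
  moreover have "AE x in M. u x = Re (g x)" using eq by eventually_elim (metis Re_complex_of_real)
  ultimately show "u \<in> Linf_real M \<and> (\<exists>w\<in>borel_measurable F. AE x in M. u x = w x)"
    using u by (auto simp: real_members_iff)
next
  assume u: "u \<in> Linf_real M \<and> (\<exists>w\<in>borel_measurable F. AE x in M. u x = w x)"
  then obtain w where [measurable]: "w \<in> borel_measurable F" and eq: "AE x in M. u x = w x" by blast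
  have "(\<lambda>x. complex_of_real (u x)) \<in> members M (Linf_sub M F)"
  proof (rule members_Linf_subI[OF F])
    show "(\<lambda>x. complex_of_real (u x)) \<in> Linf_fun M" using u by (simp add: of_real_Linf_fun_iff)
    show "(\<lambda>x. complex_of_real (w x)) \<in> borel_measurable F" by measurable
    show "AE x in M. complex_of_real (u x) = complex_of_real (w x)" using eq by eventually_elim simp
  qed
  then show "u \<in> real_members M (Linf_sub M F)" by (simp add: real_members_def)
qed

lemma integrable_indicator_Linf_real:
  assumes A: "A \<in> sets M" "emeasure M A < \<infinity>" and k: "k \<in> Linf_real M"
  shows "integrable M (\<lambda>x. indicator A x * k x)"
  using integrable_Linf_real_mult[OF k integrable_real_indicator[OF A]] by (simp add: mult.commute)

text \<open>With \<open>w\<close> the conditional expectation of \<open>u\<close> on \<open>A\<close>, the function \<open>indicator A * (u - w)\<close>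
  annihilates the subalgebra, hence also \<open>u\<close>, so that \<open>(u - w)\<^sup>2\<close> has integral zero on \<open>A\<close>.\<close>

lemma annihilated_locally_measurable:
  assumes F: "subalgebra M F" and A: "A \<in> sets M" "emeasure M A < \<infinity>"
    and u: "u \<in> Linf_real M"
    and ann: "\<And>h :: 'a \<Rightarrow> real. integrable M h \<Longrightarrow>
      (\<And>w. w \<in> borel_measurable F \<Longrightarrow> w \<in> Linf_real M \<Longrightarrow> (\<integral>x. w x * h x \<partial>M) = 0) \<Longrightarrow>
      (\<integral>x. u x * h x \<partial>M) = 0"
  shows "\<exists>w\<in>borel_measurable F. AE x in M. x \<in> A \<longrightarrow> u x = w x"
proof -
  \<comment> \<open>Cutting M down to A by a density keeps the underlying \<sigma>-algebra, so F
    stays a subalgebra, and makes the measure finite, so that conditional expectations are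
    available.\<close>
  define K where "K = density M (\<lambda>x. ennreal (indicator A x))"
  have [measurable]: "A \<in> sets M" "u \<in> borel_measurable M" using A u by (auto dest: Linf_realD)
  have AE_K: "(AE x in K. P x) \<longleftrightarrow> (AE x in M. x \<in> A \<longrightarrow> P x)" for P
    unfolding K_def by (subst AE_density) (auto simp: indicator_def)
  have int_K: "(\<integral>x. k x \<partial>K) = (\<integral>x. indicator A x * k x \<partial>M)"
    if "k \<in> borel_measurable M" for k :: "'a \<Rightarrow> real"
    unfolding K_def using that by (subst integral_density) simp_all
  have integrable_K: "integrable K k \<longleftrightarrow> integrable M (\<lambda>x. indicator A x * k x)"
    if "k \<in> borel_measurable M" for k :: "'a \<Rightarrow> real"
    unfolding K_def using that by (subst integrable_density) simp_all
  have "finite_measure K"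
    using A unfolding K_def by (intro finite_measureI) (simp add: emeasure_density space_density ennreal_indicator)
  moreover have subK: "subalgebra K F" using F by (simp add: subalgebra_def K_def)
  ultimately interpret K: finite_measure_subalgebra K F
    by (simp add: finite_measure_subalgebra_def finite_measure_subalgebra_axioms_def)
  obtain C where C: "AE x in M. \<bar>u x\<bar> \<le> C" using u by (auto simp: Linf_real_def)
  have iu: "integrable K u"
    using integrable_indicator_Linf_real[OF A u] by (simp add: integrable_K)
  define e where "e = real_cond_exp K F u"
  have [measurable]: "e \<in> borel_measurable F" unfolding e_def by simp
  have "AE x in K. e x \<le> C" "AE x in K. - C \<le> e x"
    unfolding e_def
    by (rule K.real_cond_exp_le_c[OF iu] K.real_cond_exp_ge_c[OF iu];
      use C in \<open>auto simp: AE_K elim!: eventually_mono\<close>)+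
  then have eC: "AE x in K. \<bar>e x\<bar> \<le> C" by eventually_elim simp
  \<comment> \<open>The bounds on e hold K-a.e., which says nothing off A. Clamping makes w
    essentially bounded for M, so that w can itself serve as a test function in
    \<open>orth\<close>.\<close>
  define w where "w x = max (- \<bar>C\<bar>) (min \<bar>C\<bar> (e x))" for x
  have w: "w \<in> borel_measurable F" unfolding w_def by measurable
  then have wM[measurable]: "w \<in> borel_measurable M" by (rule measurable_from_subalg[OF F])
  have "AE x in M. \<bar>w x\<bar> \<le> \<bar>C\<bar>" by (intro AE_I2) (simp add: w_def)
  then have wL: "w \<in> Linf_real M" using wM by (auto simp: Linf_real_def)
  have we: "AE x in K. w x = e x" using eC by eventually_elim (simp add: w_def)
  define h where "h x = indicator A x * (u x - w x)" for x
  have uwL: "(\<lambda>x. u x - w x) \<in> Linf_real M"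
  proof (rule Linf_real_bounded_by[OF _ _ Linf_real_abs_add[OF u wL]])
    show "AE x in M. \<bar>u x - w x\<bar> \<le> \<bar>\<bar>u x\<bar> + \<bar>w x\<bar>\<bar>" by (intro AE_I2) linarith
  qed measurable
  have h: "integrable M h" unfolding h_def by (rule integrable_indicator_Linf_real[OF A uwL])
  \<comment> \<open>The defining identity of the conditional expectation against the F-measurable
    weight k, carried back from K to M.\<close>
  have orth: "(\<integral>x. k x * h x \<partial>M) = 0" if k: "k \<in> borel_measurable F" "k \<in> Linf_real M" for k
  proof -
    have [measurable]: "k \<in> borel_measurable M" using k(2) by (rule Linf_realD)
    have [measurable]: "e \<in> borel_measurable M"
      by (rule measurable_from_subalg[OF F]) measurable
    have i: "integrable K (\<lambda>x. k x * z x)" if z: "z \<in> Linf_real M" for z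
    proof -
      have [measurable]: "z \<in> borel_measurable M" using z by (rule Linf_realD)
      have "integrable M (\<lambda>x. k x * (indicator A x * z x))"
        by (rule integrable_Linf_real_mult[OF k(2) integrable_indicator_Linf_real[OF A z]])
      then show ?thesis by (subst integrable_K) (auto simp: mult.left_commute)
    qed
    have "(\<integral>x. k x * e x \<partial>K) = (\<integral>x. k x * u x \<partial>K)"
      unfolding e_def by (rule K.real_cond_exp_intg(2)[OF i[OF u] k(1)]) (simp add: K_def)
    moreover have "(\<integral>x. k x * e x \<partial>K) = (\<integral>x. k x * w x \<partial>K)"
    proof (rule integral_cong_AE)
      show "AE x in K. k x * e x = k x * w x" using we by eventually_elim simp
    qed (simp_all add: K_def)
    ultimately have "(\<integral>x. k x * u x - k x * w x \<partial>K) = 0"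
      by (simp add: Bochner_Integration.integral_diff[OF i[OF u] i[OF wL]])
    moreover have "(\<integral>x. k x * u x - k x * w x \<partial>K) = (\<integral>x. k x * h x \<partial>M)"
      by (subst int_K) (auto simp: h_def algebra_simps)
    ultimately show ?thesis by simp
  qed
  have "(\<integral>x. u x * h x - w x * h x \<partial>M) = 0"
    by (subst Bochner_Integration.integral_diff)
       (simp_all add: ann[OF h orth] orth[OF w wL] integrable_Linf_real_mult u wL h)
  moreover have sq: "u x * h x - w x * h x = indicator A x * (u x - w x)\<^sup>2" for x
    by (simp add: h_def power2_eq_square algebra_simps)
  moreover have "integrable M (\<lambda>x. u x * h x - w x * h x)"
    by (intro Bochner_Integration.integrable_diff integrable_Linf_real_mult u wL h)
  ultimately have "AE x in M. indicator A x * (u x - w x)\<^sup>2 = 0"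
    by (subst integral_nonneg_eq_0_iff_AE[symmetric]) auto
  then have "AE x in M. x \<in> A \<longrightarrow> u x = w x" by eventually_elim (auto simp: indicator_def)
  with w show ?thesis by blast
qed

text \<open>F may lack null sets, so H itself can lie outside F; only its class is known to come
  from a set of F.\<close>

lemma essentially_order_closed_ess_union:
  assumes "essentially_order_closed M F" "subalgebra M F" "\<E> \<subseteq> sets F" "is_ess_union M \<E> H"
  shows "\<exists>G\<in>sets F. AE x in M. x \<in> H \<longleftrightarrow> x \<in> G"
proof -
  have sub: "\<E> \<subseteq> sets M" "sets F \<subseteq> sets M" using assms(2,3) by (auto simp: subalgebra_def)
  have H: "H \<in> sets M" using assms(4) by (simp add: is_ess_union_def)
  have "is_supremum M (projections M (Linf M)) ((\<lambda>E. cls M (indicator E)) ` \<E>) (cls M (indicator H))"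
    using is_supremum_projections_iff[OF sub(1) H] assms(4) by simp
  moreover have "(\<lambda>E. cls M (indicator E)) ` \<E> \<subseteq> {cls M (indicator E) |E. E \<in> sets F}"
    using assms(3) by auto
  ultimately have "cls M (indicator H) \<in> {cls M (indicator E) |E. E \<in> sets F}"
    by (intro assms(1)[unfolded essentially_order_closed_def, rule_format])
  then obtain G where G: "G \<in> sets F" "cls M (indicator H) = cls M (indicator G)" by auto
  then have "AE x in M. indicator H x = (indicator G x :: complex)"
    using H sub(2) by (subst (asm) cls_eq_iff) (auto intro: Linf_fun_indicator)
  then have "AE x in M. x \<in> H \<longleftrightarrow> x \<in> G"
    by eventually_elim (auto simp: indicator_def split: if_splits)
  with G(1) show ?thesis by blast
qed

lemma localizable_finite_subset:
  assumes "localizable M" "D \<in> sets M" "\<not> (AE x in M. x \<notin> D)"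
  shows "\<exists>A\<in>sets M. A \<subseteq> D \<and> emeasure M A < \<infinity> \<and> \<not> (AE x in M. x \<notin> A)"
proof (cases "emeasure M D = \<infinity>")
  case True
  then obtain A where A: "A \<in> sets M" "A \<subseteq> D" "0 < emeasure M A" "emeasure M A < \<infinity>"
    using assms(1,2) unfolding localizable_def by blast
  moreover have "\<not> (AE x in M. x \<notin> A)"
    using A(1,3) AE_iff_null_sets[OF A(1)] by auto
  ultimately show ?thesis by blast
next
  case False
  then show ?thesis using assms(2,3) by (intro bexI[of _ D]) (auto simp: less_top)
qed

text \<open>For \<open>A\<close> of finite measure in \<open>E\<close>, let \<open>C\<close> be the smallest set of \<open>F\<close> containing \<open>A\<close>. If \<open>C\<close>
  were not below \<open>E\<close>, a set of \<open>F\<close> agreeing with \<open>E\<close> on \<open>A\<close> and on a piece of \<open>C - E\<close> of finite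
  measure would be a smaller one. Hence \<open>E\<close> is the essential union of the sets of \<open>F\<close> below it.\<close>

lemma locally_in_subalgebra:
  assumes loc: "localizable M" and F: "subalgebra M F" and oc: "essentially_order_closed M F"
    and E: "E \<in> sets M"
    and local: "\<And>A. A \<in> sets M \<Longrightarrow> emeasure M A < \<infinity> \<Longrightarrow>
      \<exists>B\<in>sets F. AE x in M. x \<in> A \<longrightarrow> (x \<in> B \<longleftrightarrow> x \<in> E)"
  shows "\<exists>B\<in>sets F. AE x in M. x \<in> E \<longleftrightarrow> x \<in> B"
proof -
  have FM: "sets F \<subseteq> sets M" and sp: "space F = space M" using F by (auto simp: subalgebra_def)
  define \<B> where "\<B> = {G \<in> sets F. ae_subset M G E}"
  have \<B>: "\<B> \<subseteq> sets F" by (auto simp: \<B>_def)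
  obtain H where H: "is_ess_union M \<B> H" using ess_union_exists[OF loc] \<B> FM by blast
  obtain B where B: "B \<in> sets F" "AE x in M. x \<in> H \<longleftrightarrow> x \<in> B"
    using essentially_order_closed_ess_union[OF oc F \<B> H] by blast
  have BM: "B \<in> sets M" using B(1) FM by blast
  have HE: "ae_subset M H E" using H E by (auto simp: is_ess_union_def \<B>_def)
  have "AE x in M. x \<notin> E - B"
  proof (rule ccontr)
    assume "\<not> (AE x in M. x \<notin> E - B)"
    then obtain A where A: "A \<in> sets M" "A \<subseteq> E - B" "emeasure M A < \<infinity>" "\<not> (AE x in M. x \<notin> A)"
      using localizable_finite_subset[OF loc, of "E - B"] E BM by blast
    \<comment> \<open>Only suprema are available, so the smallest set of F above A is obtained as
      the complement of the essential union of the sets of F that miss A a.e.\<close>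
    define \<D> where "\<D> = {G \<in> sets F. AE x in M. x \<in> A \<longrightarrow> x \<notin> G}"
    have \<D>: "\<D> \<subseteq> sets F" by (auto simp: \<D>_def)
    obtain K where K: "is_ess_union M \<D> K" using ess_union_exists[OF loc] \<D> FM by blast
    obtain K' where K': "K' \<in> sets F" "AE x in M. x \<in> K \<longleftrightarrow> x \<in> K'"
      using essentially_order_closed_ess_union[OF oc F \<D> K] by blast
    define C where "C = space M - K'"
    have C: "C \<in> sets F" using sets.compl_sets[OF K'(1)] sp by (simp add: C_def)
    have CM: "C \<in> sets M" using C FM by blast
    have Csmall: "ae_subset M C G" if G: "G \<in> sets F" "ae_subset M A G" for G
    proof -
      have "AE x in M. x \<in> A \<longrightarrow> x \<notin> space M - G" using G(2) by eventually_elim simp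
      then have "space M - G \<in> \<D>" using sets.compl_sets[OF G(1)] sp by (simp add: \<D>_def)
      then have "ae_subset M (space M - G) K" using K unfolding is_ess_union_def by blast
      with K'(2) AE_space show ?thesis by eventually_elim (auto simp: C_def)
    qed
    have AC: "ae_subset M A C"
    proof -
      have "ae_subset M G (space M - A)" if "G \<in> \<D>" for G
      proof -
        have "AE x in M. x \<in> A \<longrightarrow> x \<notin> G" using that by (simp add: \<D>_def)
        with AE_space show ?thesis by eventually_elim auto
      qed
      then have "ae_subset M K (space M - A)"
        using K sets.compl_sets[OF A(1)] unfolding is_ess_union_def by blast
      with K'(2) AE_space show ?thesis by eventually_elim (auto simp: C_def)
    qed
    have "ae_subset M C E"
    proof (rule ccontr)
      assume "\<not> ae_subset M C E"
      moreover have "ae_subset M C E" if "AE x in M. x \<notin> C - E" using that by eventually_elim blast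
      ultimately obtain A' where A': "A' \<in> sets M" "A' \<subseteq> C - E" "emeasure M A' < \<infinity>" "\<not> (AE x in M. x \<notin> A')"
        using localizable_finite_subset[OF loc, of "C - E"] E CM by blast
      have "emeasure M (A \<union> A') \<le> emeasure M A + emeasure M A'"
        using A A' by (intro emeasure_subadditive) auto
      also have "\<dots> < \<infinity>" using A(3) A'(3) by (simp add: ennreal_add_less_top)
      finally obtain G where G: "G \<in> sets F" "AE x in M. x \<in> A \<union> A' \<longrightarrow> (x \<in> G \<longleftrightarrow> x \<in> E)"
        using local[of "A \<union> A'"] A A' by auto
      \<comment> \<open>A lies in E and A' outside it, so up to null sets G contains A and misses
        A'. Minimality puts C, and with it A', below G; hence A' is null.\<close>
      have "ae_subset M A G" using G(2) by eventually_elim (use A(2) in blast)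
      from Csmall[OF G(1) this] G(2) have "AE x in M. x \<notin> A'"
        by eventually_elim (use A'(2) in blast)
      with A'(4) show False by blast
    qed
    \<comment> \<open>Now C is one of the sets whose essential union is B, so A lies a.e. below B
      although it is disjoint from B.\<close>
    then have "C \<in> \<B>" using C by (simp add: \<B>_def)
    then have "ae_subset M C H" using H by (simp add: is_ess_union_def)
    with AC B(2) have "AE x in M. x \<notin> A" by eventually_elim (use A(2) in blast)
    with A(4) show False by blast
  qed
  with HE B(2) have "AE x in M. x \<in> E \<longleftrightarrow> x \<in> B" by eventually_elim blast
  with B(1) show ?thesis by blast
qed

lemma (in linf_subalgebra) weak_star_closed_if_Linf_sub:
  assumes loc: "localizable M" and F: "subalgebra M F" and oc: "essentially_order_closed M F"
    and N: "N = Linf_sub M F"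
  shows "closedin (weak_star_topology M) N"
proof -
  define H where "H = {g. integrable M g \<and> (\<forall>\<phi>\<in>N. L1_pairing M \<phi> g = 0)}"
  \<comment> \<open>Real-valued annihilators suffice, since the function tested in
    \<open>annihilated_locally_measurable\<close> is real.\<close>
  have real: "u \<in> real_members M N"
    if u: "u \<in> Linf_real M"
      and ann: "\<And>h. integrable M h \<Longrightarrow> (\<lambda>x. complex_of_real (h x)) \<in> H \<Longrightarrow> (\<integral>x. u x * h x \<partial>M) = 0" for u
  proof (rule real_members_spectral[OF u])
    fix t
    have [measurable]: "u \<in> borel_measurable M" using u by (rule Linf_realD)
    let ?E = "{x \<in> space M. t < u x}"
    have E: "?E \<in> sets M" by measurable
    have annih: "(\<integral>x. u x * h x \<partial>M) = 0"
      if h: "integrable M h"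
        and orth: "\<And>w. w \<in> borel_measurable F \<Longrightarrow> w \<in> Linf_real M \<Longrightarrow> (\<integral>x. w x * h x \<partial>M) = 0" for h
    proof (rule ann[OF h])
      have ih: "integrable M (\<lambda>x. complex_of_real (h x))" using h by simp
      have zero: "(\<integral>x. k x * h x \<partial>M) = 0" if k: "k \<in> real_members M N" for k
      proof -
        obtain w where w: "w \<in> borel_measurable F" "AE x in M. k x = w x" and kL: "k \<in> Linf_real M"
          using k by (auto simp: N real_members_Linf_sub_iff[OF F])
        have wM: "w \<in> borel_measurable M" using w(1) by (rule measurable_from_subalg[OF F])
        have "AE x in M. \<bar>w x\<bar> \<le> \<bar>k x\<bar>" using w(2) by eventually_elim simp
        then have wL: "w \<in> Linf_real M" by (rule Linf_real_bounded_by[OF wM _ kL])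
        have [measurable]: "k \<in> borel_measurable M" "w \<in> borel_measurable M" "h \<in> borel_measurable M"
          using kL wM h by (auto dest: Linf_realD)
        have "(\<integral>x. k x * h x \<partial>M) = (\<integral>x. w x * h x \<partial>M)"
        proof (rule integral_cong_AE)
          show "AE x in M. k x * h x = w x * h x" using w(2) by eventually_elim simp
        qed measurable
        then show ?thesis using orth[OF w(1) wL] by simp
      qed
      \<comment> \<open>A pairing with a real function splits into the pairings of the real and
        imaginary parts, both of which belong to N.\<close>
      have "L1_pairing M \<phi> (\<lambda>x. complex_of_real (h x)) = 0" if \<phi>: "\<phi> \<in> N" for \<phi>
      proof -
        obtain f where f: "f \<in> members M N" "\<phi> = cls M f" using mem_iff_members[OF sub_Linf] \<phi> by blast
        have "integrable M (\<lambda>x. f x * complex_of_real (h x))"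
          by (rule integrable_Linf_mult[OF membersD(1)[OF f(1)] ih])
        then have "Re (\<integral>x. f x * complex_of_real (h x) \<partial>M) = 0" "Im (\<integral>x. f x * complex_of_real (h x) \<partial>M) = 0"
          using zero[OF members_Re[OF f(1)]] zero[OF members_Im[OF f(1)]]
          by (simp_all flip: integral_Re integral_Im)
        then show ?thesis unfolding f(2) L1_pairing_cls[OF membersD(1)[OF f(1)] ih] by (simp add: complex_eq_iff)
      qed
      then show "(\<lambda>x. complex_of_real (h x)) \<in> H" using ih by (simp add: H_def)
    qed
    have "\<exists>B\<in>sets F. AE x in M. x \<in> ?E \<longleftrightarrow> x \<in> B"
    proof (rule locally_in_subalgebra[OF loc F oc E])
      fix A assume A: "A \<in> sets M" "emeasure M A < \<infinity>"
      obtain w where [measurable]: "w \<in> borel_measurable F" and w: "AE x in M. x \<in> A \<longrightarrow> u x = w x"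
        using annihilated_locally_measurable[OF F A u annih] by blast
      have "{x \<in> space F. t < w x} \<in> sets F" by measurable
      moreover have "AE x in M. x \<in> A \<longrightarrow> (x \<in> {x \<in> space F. t < w x} \<longleftrightarrow> x \<in> ?E)"
        using w AE_space by eventually_elim (use F in \<open>auto simp: subalgebra_def\<close>)
      ultimately show "\<exists>B\<in>sets F. AE x in M. x \<in> A \<longrightarrow> (x \<in> B \<longleftrightarrow> x \<in> ?E)" by blast
    qed
    then obtain B where [measurable]: "B \<in> sets F" and B: "AE x in M. x \<in> ?E \<longleftrightarrow> x \<in> B" by blast
    have "(indicator B :: 'a \<Rightarrow> real) \<in> borel_measurable F" by measurable
    moreover have "AE x in M. indicator ?E x = (indicator B x :: real)"
      using B by eventually_elim (simp add: indicator_def)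
    ultimately show "indicator ?E \<in> real_members M N"
      unfolding N real_members_Linf_sub_iff[OF F]
      by (intro conjI indicator_Linf_real[OF E] bexI[of _ "indicator B"])
  qed
  have "N = {\<phi> \<in> Linf M. \<forall>g\<in>H. L1_pairing M \<phi> g = 0}"
  proof (intro equalityI subsetI)
    fix \<phi> assume "\<phi> \<in> N"
    then show "\<phi> \<in> {\<phi> \<in> Linf M. \<forall>g\<in>H. L1_pairing M \<phi> g = 0}" using sub_Linf by (auto simp: H_def)
  next
    fix \<phi> assume \<phi>: "\<phi> \<in> {\<phi> \<in> Linf M. \<forall>g\<in>H. L1_pairing M \<phi> g = 0}"
    define f where "f = rep \<phi>"
    have f: "f \<in> Linf_fun M" "cls M f = \<phi>" using \<phi> cls_rep[of \<phi> M] by (auto simp: f_def)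
    have "(\<integral>x. Re (f x) * h x \<partial>M) = 0 \<and> (\<integral>x. Im (f x) * h x \<partial>M) = 0"
      if h: "integrable M h" "(\<lambda>x. complex_of_real (h x)) \<in> H" for h
    proof -
      have ih: "integrable M (\<lambda>x. complex_of_real (h x))" using h by simp
      have "(\<integral>x. f x * complex_of_real (h x) \<partial>M) = 0"
        using \<phi> h(2) L1_pairing_cls[OF f(1) ih] f(2) by auto
      then show ?thesis
        using integral_Re[OF integrable_Linf_mult[OF f(1) ih]] integral_Im[OF integrable_Linf_mult[OF f(1) ih]]
        by simp
    qed
    then have "f \<in> members M N"
      by (intro members_cartesian real Re_Linf_real Im_Linf_real f(1)) auto
    then show "\<phi> \<in> N" using f(2) membersD(2) by blast
  qed
  then show ?thesis using closedin_weak_star_annihilator[of H M] by (simp add: H_def)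
qed

theorem theorem7p27:
  fixes M :: "'a measure" and N :: "('a \<Rightarrow> complex) set set"
  assumes "localizable M" and "unital_cstar_subalgebra M N"
  shows "(densely_spanned_by_projections M N \<and> projections_order_closed M N
            \<longleftrightarrow> sa_monotone_closed M N)
       \<and> (sa_monotone_closed M N \<longleftrightarrow> closedin (weak_star_topology M) N)
       \<and> (closedin (weak_star_topology M) N \<longleftrightarrow>
            (\<exists>F. subalgebra M F \<and> essentially_order_closed M F \<and> N = Linf_sub M F))"
proof -
  interpret linf_subalgebra M N by unfold_locales (rule assms(2))
  let ?i = "densely_spanned_by_projections M N \<and> projections_order_closed M N"
  let ?ii = "sa_monotone_closed M N"
  let ?iii = "closedin (weak_star_topology M) N"
  let ?iv = "\<exists>F. subalgebra M F \<and> essentially_order_closed M F \<and> N = Linf_sub M F"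
  have "?i \<Longrightarrow> ?iv" using Linf_sub_if_spanned_by_projections by blast
  moreover have "?iv \<Longrightarrow> ?iii" using weak_star_closed_if_Linf_sub[OF assms(1)] by blast
  moreover have "?iii \<Longrightarrow> ?ii" by (rule monotone_closed_if_weak_star_closed)
  moreover have "?ii \<Longrightarrow> ?i"
    using spanned_by_projections_if_monotone_closed projections_order_closed_if_monotone_closed by blast
  ultimately show ?thesis by blast
qed

end
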